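(* Let $s\in(0,1)$, let $\Omega\subset\mathbb{R}^N$ be a bounded strictly convex domain of class $C^2$, and let $f\in C(\overline\Omega)$ and $g\in C(\overline{\mathbb{R}^N\setminus\Omega})$ be bounded. Let $u,v\colon\mathbb{R}^N\to\mathbb{R}$ be, respectively, a viscosity subsolution and a viscosity supersolution (in the sense described in the context) of \[ \begin{cases} \displaystyle \Lambda_1^s u(x)\coloneqq \inf\left\{\int_{\mathbb{R}}\frac{u(x+tz)-u(x)}{|t|^{1+2s}}\,dt\colon z\in\mathbb{S}^{N-1}\right\}=f(x), & x\in\Omega,\\[6pt] u(x)=g(x), & x\in\mathbb{R}^N\setminus\Omega. \end{cases} \] Then $u\le v$ in $\mathbb{R}^N$.
   Context: Integrals are principal value integrals; $\mathbb{S}^{N-1}$ is the unit sphere. For $u\colon\overline\Omega\to\mathbb{R}$ let the upper $g$-extension be $u^g=u$ in $\Omega$, $u^g=g$ in $\mathbb{R}^N\setminus\overline\Omega$, $u^g=\max\{u,g\}$ on $\partial\Omega$; the lower $g$-extension $u_g$ uses $\min$ instead. For $\delta>0$, $z\in\mathbb{S}^{N-1}$, a $C^2$ function $\phi$ and a function $w$, set $E_{z,\delta}(w,\phi,x)\coloneqq\int_{-\delta}^{\delta}\frac{\phi(x+tz)-\phi(x)}{|t|^{1+2s}}dt+\int_{\mathbb{R}\setminus(-\delta,\delta)}\frac{w(x+tz)-u(x)}{|t|^{1+2s}}dt-f(x)$ and $E_\delta(w,\phi,x)\coloneqq-\inf_{z\in\mathbb{S}^{N-1}}E_{z,\delta}(w,\phi,x)$.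 A bounded upper semicontinuous $u\colon\mathbb{R}^N\to\mathbb{R}$ is a viscosity subsolution if $u\le g$ in $\mathbb{R}^N\setminus\overline\Omega$ and for every $\delta>0$ and $\phi\in C^2(\mathbb{R}^N)$ such that $x_0$ is a maximum point of $u-\phi$ in $B_\delta(x_0)$: $E_\delta(u^g,\phi,x_0)\le0$ if $x_0\in\Omega$, and $\min\{E_\delta(u^g,\phi,x_0),u(x_0)-g(x_0)\}\le 0$ if $x_0\in\partial\Omega$ (if $u$ is not upper semicontinuous, this is required of its upper semicontinuous envelope). Viscosity supersolutions are defined analogously, with lower semicontinuity, $u_g$, minimum points and reversed inequalities (with $\max$ instead of $\min$ on $\partial\Omega$). *)

theory Defs
  imports "HOL-Analysis.Analysis"
begin

definition C2_on :: "'a::euclidean_space set \<Rightarrow> ('a \<Rightarrow> real) \<Rightarrow> bool" where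
  "C2_on S \<phi> \<longleftrightarrow> open S \<and>
     (\<exists>(D :: 'a \<Rightarrow> 'a \<Rightarrow>\<^sub>L real) (D2 :: 'a \<Rightarrow> 'a \<Rightarrow>\<^sub>L ('a \<Rightarrow>\<^sub>L real)).
        (\<forall>x\<in>S. (\<phi> has_derivative blinfun_apply (D x)) (at x)) \<and>
        (\<forall>x\<in>S. (D has_derivative blinfun_apply (D2 x)) (at x)) \<and>
        continuous_on S D2)"

definition C2_domain :: "'a::euclidean_space set \<Rightarrow> bool" where
  "C2_domain \<Omega> \<longleftrightarrow> open \<Omega> \<and> connected \<Omega> \<and> \<Omega> \<noteq> {} \<and>
     (\<forall>x0\<in>frontier \<Omega>. \<exists>r>0. \<exists>(\<rho> :: 'a \<Rightarrow> real) (D :: 'a \<Rightarrow> 'a \<Rightarrow>\<^sub>L real)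
        (D2 :: 'a \<Rightarrow> 'a \<Rightarrow>\<^sub>L ('a \<Rightarrow>\<^sub>L real)).
        (\<forall>x\<in>ball x0 r. (\<rho> has_derivative blinfun_apply (D x)) (at x)) \<and>
        (\<forall>x\<in>ball x0 r. (D has_derivative blinfun_apply (D2 x)) (at x)) \<and>
        continuous_on (ball x0 r) D2 \<and>
        (\<forall>x\<in>ball x0 r. D x \<noteq> 0) \<and>
        \<Omega> \<inter> ball x0 r = {x\<in>ball x0 r. \<rho> x < 0})"

definition strictly_convex :: "'a::euclidean_space set \<Rightarrow> bool" where
  "strictly_convex \<Omega> \<longleftrightarrow> convex \<Omega> \<and>
     (\<forall>x\<in>closure \<Omega>. \<forall>y\<in>closure \<Omega>. x \<noteq> y \<longrightarrow> open_segment x y \<subseteq> \<Omega>)"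

definition upper_ext :: "'a::euclidean_space set \<Rightarrow> ('a \<Rightarrow> real) \<Rightarrow> ('a \<Rightarrow> real) \<Rightarrow> 'a \<Rightarrow> real" where
  "upper_ext \<Omega> g u x = (if x \<in> \<Omega> then u x else if x \<in> frontier \<Omega> then max (u x) (g x) else g x)"

definition lower_ext :: "'a::euclidean_space set \<Rightarrow> ('a \<Rightarrow> real) \<Rightarrow> ('a \<Rightarrow> real) \<Rightarrow> 'a \<Rightarrow> real" where
  "lower_ext \<Omega> g u x = (if x \<in> \<Omega> then u x else if x \<in> frontier \<Omega> then min (u x) (g x) else g x)"

definition usc_envelope :: "('a::metric_space \<Rightarrow> real) \<Rightarrow> 'a \<Rightarrow> real" where
  "usc_envelope u x = (INF e\<in>{0<..}. SUP y\<in>ball x e. u y)"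

definition lsc_envelope :: "('a::metric_space \<Rightarrow> real) \<Rightarrow> 'a \<Rightarrow> real" where
  "lsc_envelope u x = (SUP e\<in>{0<..}. INF y\<in>ball x e. u y)"

definition E_z :: "real \<Rightarrow> ('a::euclidean_space \<Rightarrow> real) \<Rightarrow> ('a \<Rightarrow> real) \<Rightarrow> ('a \<Rightarrow> real)
    \<Rightarrow> ('a \<Rightarrow> real) \<Rightarrow> real \<Rightarrow> 'a \<Rightarrow> 'a \<Rightarrow> real" where
  "E_z s f u w \<phi> \<delta> z x =
     Lim (at_right 0) (\<lambda>\<epsilon>. integral {t. \<epsilon> < \<bar>t\<bar> \<and> \<bar>t\<bar> < \<delta>}
          (\<lambda>t. (\<phi> (x + t *\<^sub>R z) - \<phi> x) / \<bar>t\<bar> powr (1 + 2 * s)))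
   + Lim at_top (\<lambda>R. integral {t. \<delta> \<le> \<bar>t\<bar> \<and> \<bar>t\<bar> \<le> R}
          (\<lambda>t. (w (x + t *\<^sub>R z) - u x) / \<bar>t\<bar> powr (1 + 2 * s)))
   - f x"

definition E_delta :: "real \<Rightarrow> ('a::euclidean_space \<Rightarrow> real) \<Rightarrow> ('a \<Rightarrow> real) \<Rightarrow> ('a \<Rightarrow> real)
    \<Rightarrow> ('a \<Rightarrow> real) \<Rightarrow> real \<Rightarrow> 'a \<Rightarrow> real" where
  "E_delta s f u w \<phi> \<delta> x = - (INF z\<in>sphere 0 1. E_z s f u w \<phi> \<delta> z x)"

definition visc_sub_usc :: "real \<Rightarrow> 'a::euclidean_space set \<Rightarrow> ('a \<Rightarrow> real) \<Rightarrow> ('a \<Rightarrow> real)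
    \<Rightarrow> ('a \<Rightarrow> real) \<Rightarrow> bool" where
  "visc_sub_usc s \<Omega> f g u \<longleftrightarrow>
     (\<forall>x. x \<notin> closure \<Omega> \<longrightarrow> u x \<le> g x) \<and>
     (\<forall>\<delta>>0. \<forall>\<phi> x0. C2_on UNIV \<phi> \<longrightarrow> (\<forall>y\<in>ball x0 \<delta>. u y - \<phi> y \<le> u x0 - \<phi> x0) \<longrightarrow>
        (x0 \<in> \<Omega> \<longrightarrow> E_delta s f u (upper_ext \<Omega> g u) \<phi> \<delta> x0 \<le> 0) \<and>
        (x0 \<in> frontier \<Omega> \<longrightarrow> min (E_delta s f u (upper_ext \<Omega> g u) \<phi> \<delta> x0) (u x0 - g x0) \<le> 0))"

definition visc_super_lsc :: "real \<Rightarrow> 'a::euclidean_space set \<Rightarrow> ('a \<Rightarrow> real) \<Rightarrow> ('a \<Rightarrow> real)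
    \<Rightarrow> ('a \<Rightarrow> real) \<Rightarrow> bool" where
  "visc_super_lsc s \<Omega> f g u \<longleftrightarrow>
     (\<forall>x. x \<notin> closure \<Omega> \<longrightarrow> u x \<ge> g x) \<and>
     (\<forall>\<delta>>0. \<forall>\<phi> x0. C2_on UNIV \<phi> \<longrightarrow> (\<forall>y\<in>ball x0 \<delta>. u y - \<phi> y \<ge> u x0 - \<phi> x0) \<longrightarrow>
        (x0 \<in> \<Omega> \<longrightarrow> E_delta s f u (lower_ext \<Omega> g u) \<phi> \<delta> x0 \<ge> 0) \<and>
        (x0 \<in> frontier \<Omega> \<longrightarrow> max (E_delta s f u (lower_ext \<Omega> g u) \<phi> \<delta> x0) (u x0 - g x0) \<ge> 0))"

text \<open>A bounded u is a viscosity subsolution if its upper semicontinuous envelope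
  (which equals u when u is usc) satisfies the conditions; dually for supersolutions.\<close>
definition visc_subsolution :: "real \<Rightarrow> 'a::euclidean_space set \<Rightarrow> ('a \<Rightarrow> real) \<Rightarrow> ('a \<Rightarrow> real)
    \<Rightarrow> ('a \<Rightarrow> real) \<Rightarrow> bool" where
  "visc_subsolution s \<Omega> f g u \<longleftrightarrow> bounded (range u) \<and> visc_sub_usc s \<Omega> f g (usc_envelope u)"

definition visc_supersolution :: "real \<Rightarrow> 'a::euclidean_space set \<Rightarrow> ('a \<Rightarrow> real) \<Rightarrow> ('a \<Rightarrow> real)
    \<Rightarrow> ('a \<Rightarrow> real) \<Rightarrow> bool" where
  "visc_supersolution s \<Omega> f g u \<longleftrightarrow> bounded (range u) \<and> visc_super_lsc s \<Omega> f g (lsc_envelope u)"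

end

theory Submission
  imports Defs "HOL-Real_Asymp.Real_Asymp"
begin

text \<open>
  Write \<open>U\<close> for the upper envelope of \<open>u\<close> and \<open>V\<close> for that of \<open>-v\<close>, so that both are upper semicontinuous
  and the claim is \<open>U + V \<le> 0\<close>.

  Boundary: if \<open>U x0 > g x0\<close>, maximise \<open>U - A l\<close> over \<open>closure \<Omega>\<close>, where \<open>l\<close> is a supporting
  functional at \<open>x0\<close> and \<open>A\<close> is large. The affine test function does not contribute to the principal
  value. Pair the points \<open>x + tz\<close> and \<open>x - tz\<close>: if both lie in \<open>closure \<Omega>\<close>, maximality bounds
  the pair by 0, and otherwise the gap \<open>U x0 - g x0\<close> makes it strictly negative. By strict convexity the
  second case holds for all \<open>t\<close> beyond a length that shrinks to 0, so the integral tends to \<open>-\<infinity>\<close> in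
  every direction \<open>z\<close>. The bound does not depend on \<open>z\<close>, so it rules out \<open>U x0 > g x0\<close> and
  \<open>V x0 > - g x0\<close> alike, although the operator is an infimum over \<open>z\<close>.

  Interior: double the variables with the penalty \<open>n |x - y|\<^sup>2\<close>. Along a common direction the near part
  of the integrals is nonpositive by maximality, and the part outside \<open>\<Omega>\<close>, where the two extensions
  cancel up to the modulus of continuity of \<open>g\<close>, is bounded above by a negative constant.
\<close>

section \<open>Principal values and tails along a line\<close>

lemma integral_abs_symmetric:
  fixes F :: "real \<Rightarrow> real"
  assumes "0 < a" "F integrable_on {a..b}" "(\<lambda>t. F (-t)) integrable_on {a..b}"
  shows "integral {t. a \<le> \<bar>t\<bar> \<and> \<bar>t\<bar> \<le> b} F = integral {a..b} (\<lambda>t. F t + F (-t))"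
proof -
  have neg: "(F has_integral integral {a..b} (\<lambda>t. F (-t))) {-b..-a}"
    using integrable_integral[OF assms(3)] has_integral_reflect_real[of "\<lambda>t. F (-t)" _ b a] by simp
  have "{-b..-a} \<inter> {a..b} = {}"
    using assms(1) by auto
  then have "(F has_integral (integral {a..b} (\<lambda>t. F (-t)) + integral {a..b} F)) ({-b..-a} \<union> {a..b})"
    by (intro has_integral_Un neg integrable_integral assms) auto
  moreover have "{-b..-a} \<union> {a..b} = {t. a \<le> \<bar>t\<bar> \<and> \<bar>t\<bar> \<le> b}"
    using assms(1) by auto
  ultimately show ?thesis
    using assms by (simp add: integral_unique integral_add)
qed

lemma has_integral_powr:
  fixes p :: real
  assumes "p > -1" "0 < a" "a \<le> b"
  shows "((\<lambda>t. t powr p) has_integral (b powr (p + 1) - a powr (p + 1)) / (p + 1)) {a..b}"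
proof -
  have "((\<lambda>t. t powr p) has_integral (b powr (p + 1) / (p + 1) - a powr (p + 1) / (p + 1))) {a..b}"
    using assms
    by (intro fundamental_theorem_of_calculus)
       (auto intro!: derivative_eq_intros
             simp flip: has_real_derivative_iff_has_vector_derivative)
  then show ?thesis
    by (simp add: diff_divide_distrib)
qed

lemma principal_value_quadratic:
  fixes s \<delta> a b :: real
  assumes "0 < s" "s < 1" "0 < \<delta>"
  shows "Lim (at_right 0) (\<lambda>\<epsilon>. integral {t. \<epsilon> < \<bar>t\<bar> \<and> \<bar>t\<bar> < \<delta>}
            (\<lambda>t. (a * t + b * t\<^sup>2) / \<bar>t\<bar> powr (1 + 2 * s)))
         = b * \<delta> powr (2 - 2 * s) / (1 - s)"
proof (rule tendsto_Lim)
  let ?F = "\<lambda>t. (a * t + b * t\<^sup>2) / \<bar>t\<bar> powr (1 + 2 * s)"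
  let ?G = "\<lambda>\<epsilon>. 2 * b * ((\<delta> powr (2 - 2 * s) - \<epsilon> powr (2 - 2 * s)) / (2 - 2 * s))"
  have eq: "integral {t. \<epsilon> < \<bar>t\<bar> \<and> \<bar>t\<bar> < \<delta>} ?F = ?G \<epsilon>" if e: "0 < \<epsilon>" "\<epsilon> < \<delta>" for \<epsilon>
  proof -
    have "integral {t. \<epsilon> < \<bar>t\<bar> \<and> \<bar>t\<bar> < \<delta>} ?F = integral {t. \<epsilon> \<le> \<bar>t\<bar> \<and> \<bar>t\<bar> \<le> \<delta>} ?F"
    proof (rule integral_spike_set)
      have "negligible {\<epsilon>, -\<epsilon>, \<delta>, -\<delta>}"
        by simp
      then show "negligible {x \<in> {t. \<epsilon> < \<bar>t\<bar> \<and> \<bar>t\<bar> < \<delta>} - {t. \<epsilon> \<le> \<bar>t\<bar> \<and> \<bar>t\<bar> \<le> \<delta>}. ?F x \<noteq> 0}"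
        by (rule negligible_subset) auto
      show "negligible {x \<in> {t. \<epsilon> \<le> \<bar>t\<bar> \<and> \<bar>t\<bar> \<le> \<delta>} - {t. \<epsilon> < \<bar>t\<bar> \<and> \<bar>t\<bar> < \<delta>}. ?F x \<noteq> 0}"
        by (rule negligible_subset[OF \<open>negligible {\<epsilon>, -\<epsilon>, \<delta>, -\<delta>}\<close>]) auto
    qed
    also have "\<dots> = integral {\<epsilon>..\<delta>} (\<lambda>t. ?F t + ?F (-t))"
      using e by (intro integral_abs_symmetric integrable_continuous_interval)
        (auto intro!: continuous_intros)
    also have "\<dots> = integral {\<epsilon>..\<delta>} (\<lambda>t. 2 * b * t powr (1 - 2 * s))"
    proof (rule integral_cong)
      fix t assume "t \<in> {\<epsilon>..\<delta>}"
      then have t: "t > 0" using e by auto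
      have "t\<^sup>2 / t powr (1 + 2 * s) = t powr 2 / t powr (1 + 2 * s)"
        using t by simp
      also have "\<dots> = t powr (1 - 2 * s)"
        by (simp flip: powr_diff)
      finally have *: "t\<^sup>2 / t powr (1 + 2 * s) = t powr (1 - 2 * s)" .
      have "?F t + ?F (-t) = 2 * b * (t\<^sup>2 / t powr (1 + 2 * s))"
        using t by (simp flip: add_divide_distrib)
      then show "?F t + ?F (-t) = 2 * b * t powr (1 - 2 * s)"
        unfolding * .
    qed
    also have "\<dots> = ?G \<epsilon>"
      using has_integral_powr[of "1 - 2 * s" \<epsilon> \<delta>] e assms
      by (intro integral_unique has_integral_mult_right) (simp add: algebra_simps)
    finally show ?thesis .
  qed
  have "((\<lambda>\<epsilon>::real. \<epsilon> powr (2 - 2 * s)) \<longlongrightarrow> 0) (at_right 0)"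
    using assms by real_asymp
  then have "(?G \<longlongrightarrow> 2 * b * ((\<delta> powr (2 - 2 * s) - 0) / (2 - 2 * s))) (at_right 0)"
    by (intro tendsto_intros) (use assms in auto)
  also have "2 * b * ((\<delta> powr (2 - 2 * s) - 0) / (2 - 2 * s)) = b * \<delta> powr (2 - 2 * s) / (1 - s)"
    using assms by (simp add: field_simps)
  finally show "((\<lambda>\<epsilon>. integral {t. \<epsilon> < \<bar>t\<bar> \<and> \<bar>t\<bar> < \<delta>} ?F) \<longlongrightarrow> b * \<delta> powr (2 - 2 * s) / (1 - s))
    (at_right 0)"
  proof (rule Lim_transform_eventually)
    show "\<forall>\<^sub>F \<epsilon> in at_right 0. ?G \<epsilon> = integral {t. \<epsilon> < \<bar>t\<bar> \<and> \<bar>t\<bar> < \<delta>} ?F"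
      using eventually_at_right_less[of 0] eventually_at_right_real[OF assms(3)]
      by eventually_elim (use eq in auto)
  qed
qed auto

definition tail_integral :: "real \<Rightarrow> real \<Rightarrow> (real \<Rightarrow> real) \<Rightarrow> real" where
  "tail_integral s \<delta> h = integral {\<delta>..} (\<lambda>t. (h t + h (-t)) * t powr (- 1 - 2 * s))"

lemma has_integral_tail_kernel:
  fixes s \<delta> :: real
  assumes "0 < s" "0 < \<delta>"
  shows "((\<lambda>t. t powr (- 1 - 2 * s)) has_integral \<delta> powr (- 2 * s) / (2 * s)) {\<delta>..}"
  using has_integral_powr_to_inf[of "- 1 - 2 * s" \<delta>] assms by simp

lemma tail_integrable:
  fixes k :: "real \<Rightarrow> real"
  assumes "0 < s" "0 < \<delta>" "k \<in> borel_measurable borel" "\<And>t. \<bar>k t\<bar> \<le> C"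
  shows "(\<lambda>t. k t * t powr (- 1 - 2 * s)) absolutely_integrable_on {\<delta>..}"
proof (rule measurable_bounded_by_integrable_imp_absolutely_integrable)
  have "(\<lambda>t. k t * t powr (- 1 - 2 * s)) \<in> borel_measurable borel"
    using assms(3) by measurable
  then show "(\<lambda>t. k t * t powr (- 1 - 2 * s)) \<in> borel_measurable (lebesgue_on {\<delta>..})"
    by (simp add: borel_measurable_if_D measurable_completion measurable_restrict_space1)
  show "(\<lambda>t. C * t powr (- 1 - 2 * s)) integrable_on {\<delta>..}"
    using has_integral_mult_right[OF has_integral_tail_kernel[OF assms(1,2)]] by blast
  show "norm (k t * t powr (- 1 - 2 * s)) \<le> C * t powr (- 1 - 2 * s)" for t
    using assms(4)[of t] by (simp add: abs_mult mult_right_mono)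
qed simp

lemma tail_pair_integrable:
  fixes h :: "real \<Rightarrow> real"
  assumes "0 < s" "0 < \<delta>" and h: "h \<in> borel_measurable borel" "\<And>t. \<bar>h t\<bar> \<le> C"
  shows "(\<lambda>t. (h t + h (-t)) * t powr (- 1 - 2 * s)) integrable_on {\<delta>..}"
proof -
  have "(\<lambda>t. h t + h (-t)) \<in> borel_measurable borel"
    using h(1) by measurable
  moreover have "\<bar>h t + h (-t)\<bar> \<le> 2 * C" for t
    using h(2)[of t] h(2)[of "-t"] by linarith
  ultimately show ?thesis
    using tail_integrable[of s \<delta> "\<lambda>t. h t + h (-t)" "2 * C"] assms(1,2)
      absolutely_integrable_on_def by blast
qed

lemma improper_integral_eq_tail:
  fixes h :: "real \<Rightarrow> real"
  assumes "0 < s" "0 < \<delta>" "h \<in> borel_measurable borel" "\<And>t. \<bar>h t\<bar> \<le> C"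
  shows "Lim at_top (\<lambda>R. integral {t. \<delta> \<le> \<bar>t\<bar> \<and> \<bar>t\<bar> \<le> R} (\<lambda>t. h t / \<bar>t\<bar> powr (1 + 2 * s)))
       = tail_integral s \<delta> h"
proof (rule tendsto_Lim)
  let ?H = "\<lambda>t. (h t + h (-t)) * t powr (- 1 - 2 * s)"
  let ?F = "\<lambda>t. h t / \<bar>t\<bar> powr (1 + 2 * s)"
  have F: "?F t = h t * t powr (- 1 - 2 * s)" "?F (-t) = h (-t) * t powr (- 1 - 2 * s)"
    if "t \<in> {\<delta>..}" for t
  proof -
    have "t powr (- 1 - 2 * s) = 1 / t powr (1 + 2 * s)"
      using powr_minus_divide[of t "1 + 2 * s"] by simp
    then show "?F t = h t * t powr (- 1 - 2 * s)" "?F (-t) = h (-t) * t powr (- 1 - 2 * s)"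
      using assms(2) that by simp_all
  qed
  have "(\<lambda>t. h (-t)) \<in> borel_measurable borel"
    using assms(3) by measurable
  then have ai: "(\<lambda>t. h t * t powr (- 1 - 2 * s)) absolutely_integrable_on {\<delta>..}"
    "(\<lambda>t. h (-t) * t powr (- 1 - 2 * s)) absolutely_integrable_on {\<delta>..}"
    using assms by (auto intro!: tail_integrable)
  have int: "k integrable_on {\<delta>..R}" if "k absolutely_integrable_on {\<delta>..}"
    for k :: "real \<Rightarrow> real" and R
    using absolutely_integrable_on_subinterval[OF that, of \<delta> R] absolutely_integrable_on_def
    by auto
  have split: "integral {t. \<delta> \<le> \<bar>t\<bar> \<and> \<bar>t\<bar> \<le> R} ?F
      = tail_integral s \<delta> h - tail_integral s R h" if R: "\<delta> \<le> R" for R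
  proof -
    have i1: "(\<lambda>t. ?F t) integrable_on {\<delta>..R}"
      using integrable_cong[of "{\<delta>..R}" ?F "\<lambda>t. h t * t powr (- 1 - 2 * s)"] int[OF ai(1)] F by auto
    have i2: "(\<lambda>t. ?F (-t)) integrable_on {\<delta>..R}"
      using integrable_cong[of "{\<delta>..R}" "\<lambda>t. ?F (-t)" "\<lambda>t. h (-t) * t powr (- 1 - 2 * s)"]
        int[OF ai(2)] F by auto
    have "integral {t. \<delta> \<le> \<bar>t\<bar> \<and> \<bar>t\<bar> \<le> R} ?F = integral {\<delta>..R} (\<lambda>t. ?F t + ?F (-t))"
      by (rule integral_abs_symmetric[OF assms(2) i1 i2])
    also have "\<dots> = integral {\<delta>..R} ?H"
      by (rule integral_cong) (use F in \<open>auto simp: distrib_right\<close>)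
    finally have a: "integral {t. \<delta> \<le> \<bar>t\<bar> \<and> \<bar>t\<bar> \<le> R} ?F = integral {\<delta>..R} ?H" .
    have "?H integrable_on {\<delta>..R}"
      using integrable_add[OF int[OF ai(1)] int[OF ai(2)]] by (simp add: distrib_right)
    moreover have "?H integrable_on {R..}"
      using tail_pair_integrable[of s R h C] assms R by auto
    moreover have "negligible ({\<delta>..R} \<inter> {R..})"
      by (rule negligible_subset[of "{R}"]) auto
    ultimately have "integral ({\<delta>..R} \<union> {R..}) ?H = integral {\<delta>..R} ?H + integral {R..} ?H"
      by (rule integral_Un)
    moreover have "{\<delta>..R} \<union> {R..} = {\<delta>..}"
      using R by auto
    ultimately show ?thesis
      using a by (simp add: tail_integral_def)
  qed
  have "((\<lambda>R. tail_integral s R h) \<longlongrightarrow> 0) at_top"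
  proof (rule Lim_null_comparison)
    show "\<forall>\<^sub>F R in at_top. norm (tail_integral s R h) \<le> 2 * C * (R powr (- 2 * s) / (2 * s))"
      using eventually_gt_at_top[of 0]
    proof eventually_elim
      case (elim R)
      note ker = has_integral_mult_right[OF has_integral_tail_kernel[OF assms(1) elim], of "2 * C"]
      have "norm (tail_integral s R h) \<le> integral {R..} (\<lambda>t. 2 * C * t powr (- 1 - 2 * s))"
        unfolding tail_integral_def
      proof (rule integral_norm_bound_integral)
        show "?H integrable_on {R..}"
          using tail_pair_integrable[of s R h C] assms elim by auto
        show "(\<lambda>t. 2 * C * t powr (- 1 - 2 * s)) integrable_on {R..}"
          using ker by blast
        show "norm (?H t) \<le> 2 * C * t powr (- 1 - 2 * s)" for t
        proof -
          have "\<bar>h t + h (-t)\<bar> \<le> 2 * C"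
            using assms(4)[of t] assms(4)[of "-t"] by linarith
          then show ?thesis
            by (simp add: abs_mult mult_right_mono)
        qed
      qed
      then show ?case
        using integral_unique[OF ker] by simp
    qed
    show "((\<lambda>R. 2 * C * (R powr (- 2 * s) / (2 * s))) \<longlongrightarrow> 0) at_top"
      using assms(1) by real_asymp
  qed
  then have "((\<lambda>R. tail_integral s \<delta> h - tail_integral s R h) \<longlongrightarrow> tail_integral s \<delta> h - 0) at_top"
    by (intro tendsto_intros)
  then have "((\<lambda>R. integral {t. \<delta> \<le> \<bar>t\<bar> \<and> \<bar>t\<bar> \<le> R} ?F) \<longlongrightarrow> tail_integral s \<delta> h - 0) at_top"
  proof (rule Lim_transform_eventually)
    show "\<forall>\<^sub>F R in at_top. tail_integral s \<delta> h - tail_integral s R h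
        = integral {t. \<delta> \<le> \<bar>t\<bar> \<and> \<bar>t\<bar> \<le> R} ?F"
      using eventually_ge_at_top[of \<delta>] by eventually_elim (rule split[symmetric])
  qed
  then show "((\<lambda>R. integral {t. \<delta> \<le> \<bar>t\<bar> \<and> \<bar>t\<bar> \<le> R} ?F) \<longlongrightarrow> tail_integral s \<delta> h) at_top"
    by simp
qed auto

lemma tail_integral_uminus: "tail_integral s \<delta> (\<lambda>t. - h t) = - tail_integral s \<delta> h"
proof -
  have "(\<lambda>t. (- h t + - h (-t)) * t powr (- 1 - 2 * s))
      = (\<lambda>t. - ((h t + h (-t)) * t powr (- 1 - 2 * s)))"
    by (auto simp: algebra_simps)
  then show ?thesis
    by (simp add: tail_integral_def)
qed

lemma tail_integral_add:
  assumes "0 < s" "0 < \<delta>" "h \<in> borel_measurable borel" "\<And>t. \<bar>h t\<bar> \<le> C"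
    and "k \<in> borel_measurable borel" "\<And>t. \<bar>k t\<bar> \<le> D"
  shows "tail_integral s \<delta> (\<lambda>t. h t + k t) = tail_integral s \<delta> h + tail_integral s \<delta> k"
  unfolding tail_integral_def
  by (subst integral_add[symmetric, OF tail_pair_integrable[OF assms(1-4)]
        tail_pair_integrable[OF assms(1,2,5,6)]])
     (simp add: algebra_simps)

lemma tail_integral_upper_bound:
  fixes h :: "real \<Rightarrow> real"
  assumes s: "0 < s" and \<delta>: "0 < \<delta>" "\<delta> \<le> a" "a \<le> b"
    and h: "h \<in> borel_measurable borel" "\<And>t. \<bar>h t\<bar> \<le> C"
    and near: "\<And>t. \<delta> \<le> t \<Longrightarrow> t < a \<Longrightarrow> h t + h (-t) \<le> 0"
    and mid: "\<And>t. a \<le> t \<Longrightarrow> t < b \<Longrightarrow> h t + h (-t) \<le> - \<eta>"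
    and far: "\<And>t. b \<le> t \<Longrightarrow> h t + h (-t) \<le> D"
  shows "tail_integral s \<delta> h \<le> ((D + \<eta>) * b powr (- 2 * s) - \<eta> * a powr (- 2 * s)) / (2 * s)"
proof -
  let ?k = "\<lambda>t. t powr (- 1 - 2 * s)"
  let ?P = "\<lambda>t. (if t \<in> {b..} then (D + \<eta>) * ?k t else 0) + (if t \<in> {a..} then - \<eta> * ?k t else 0)"
  have "((\<lambda>t. if t \<in> {b..} then (D + \<eta>) * ?k t else 0) has_integral
      (D + \<eta>) * (b powr (- 2 * s) / (2 * s))) {\<delta>..}"
    using assms has_integral_mult_right[OF has_integral_tail_kernel[of s b], of "D + \<eta>"]
    by (subst has_integral_restrict) auto
  moreover have "((\<lambda>t. if t \<in> {a..} then - \<eta> * ?k t else 0) has_integral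
      - \<eta> * (a powr (- 2 * s) / (2 * s))) {\<delta>..}"
    using assms has_integral_mult_right[OF has_integral_tail_kernel[of s a], of "- \<eta>"]
    by (subst has_integral_restrict) auto
  ultimately have P: "(?P has_integral
      (D + \<eta>) * (b powr (- 2 * s) / (2 * s)) + - \<eta> * (a powr (- 2 * s) / (2 * s))) {\<delta>..}"
    by (rule has_integral_add)
  have "tail_integral s \<delta> h \<le> (D + \<eta>) * (b powr (- 2 * s) / (2 * s)) + - \<eta> * (a powr (- 2 * s) / (2 * s))"
    unfolding tail_integral_def
  proof (rule has_integral_le[OF integrable_integral P])
    show "(\<lambda>t. (h t + h (-t)) * ?k t) integrable_on {\<delta>..}"
      using tail_pair_integrable[OF s \<delta>(1) h] .
    fix t assume t: "t \<in> {\<delta>..}"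
    consider "t < a" | "a \<le> t" "t < b" | "b \<le> t" "a \<le> t"
      using \<delta> by linarith
    then show "(h t + h (-t)) * ?k t \<le> ?P t"
    proof cases
      case 1
      then show ?thesis
        using near[of t] t \<delta> by (auto simp: mult_nonpos_nonneg)
    next
      case 2
      then show ?thesis
        using mult_right_mono[OF mid[of t], of "?k t"] by auto
    next
      case 3
      then show ?thesis
        using mult_right_mono[OF far[of t], of "?k t"] by (auto simp: algebra_simps)
    qed
  qed
  also have "\<dots> = ((D + \<eta>) * b powr (- 2 * s) - \<eta> * a powr (- 2 * s)) / (2 * s)"
    by (simp add: diff_divide_distrib)
  finally show ?thesis .
qed

lemma tail_integral_lower_bound:
  fixes h :: "real \<Rightarrow> real"
  assumes s: "0 < s" and \<delta>: "0 < \<delta>"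
    and h: "h \<in> borel_measurable borel" "\<And>t. \<bar>h t\<bar> \<le> C"
  shows "tail_integral s \<delta> h \<ge> - 2 * C * \<delta> powr (- 2 * s) / (2 * s)"
proof -
  have "tail_integral s \<delta> (\<lambda>t. - h t) \<le> ((2 * C + 0) * \<delta> powr (- 2 * s) - 0 * \<delta> powr (- 2 * s)) / (2 * s)"
  proof (rule tail_integral_upper_bound[OF s \<delta>])
    show "(\<lambda>t. - h t) \<in> borel_measurable borel"
      using h(1) by measurable
    show "- h t + - h (-t) \<le> 2 * C" for t
      using h(2)[of t] h(2)[of "-t"] by linarith
  qed (use h(2) in auto)
  then show ?thesis
    by (simp add: tail_integral_uminus)
qed

lemma E_z_quadratic:
  fixes x z :: "'a::euclidean_space"
  assumes s: "0 < s" "s < 1" and \<delta>: "0 < \<delta>"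
    and \<phi>: "\<And>t. \<phi> (x + t *\<^sub>R z) - \<phi> x = a * t + b * t\<^sup>2"
    and w: "w \<in> borel_measurable borel" "\<And>y. \<bar>w y\<bar> \<le> C"
  shows "E_z s f u w \<phi> \<delta> z x
    = b * \<delta> powr (2 - 2 * s) / (1 - s) + tail_integral s \<delta> (\<lambda>t. w (x + t *\<^sub>R z) - u x) - f x"
proof -
  have "(\<lambda>t. w (x + t *\<^sub>R z) - u x) \<in> borel_measurable borel"
    using w(1) by measurable
  moreover have "\<bar>w (x + t *\<^sub>R z) - u x\<bar> \<le> C + \<bar>u x\<bar>" for t
    using w(2)[of "x + t *\<^sub>R z"] by linarith
  ultimately have "Lim at_top (\<lambda>R. integral {t. \<delta> \<le> \<bar>t\<bar> \<and> \<bar>t\<bar> \<le> R}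
      (\<lambda>t. (w (x + t *\<^sub>R z) - u x) / \<bar>t\<bar> powr (1 + 2 * s)))
    = tail_integral s \<delta> (\<lambda>t. w (x + t *\<^sub>R z) - u x)"
    by (rule improper_integral_eq_tail[OF s(1) \<delta>])
  then show ?thesis
    unfolding E_z_def \<phi> principal_value_quadratic[OF s \<delta>] by simp
qed

section \<open>Upper semicontinuous functions and envelopes\<close>

definition usc_fun :: "('a::topological_space \<Rightarrow> real) \<Rightarrow> bool" where
  "usc_fun f \<longleftrightarrow> (\<forall>a. open {x. f x < a})"

lemma usc_fun_nhd:
  fixes f :: "'a::metric_space \<Rightarrow> real"
  assumes "usc_fun f" "f x < a"
  obtains e where "e > 0" "\<And>y. y \<in> ball x e \<Longrightarrow> f y < a"
proof -
  have "open {x. f x < a}" "x \<in> {x. f x < a}"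
    using assms by (auto simp: usc_fun_def)
  then obtain e where "e > 0" "ball x e \<subseteq> {x. f x < a}"
    using open_contains_ball by blast
  then show ?thesis
    using that by blast
qed

lemma usc_fun_continuous:
  assumes "continuous_on UNIV f"
  shows "usc_fun f"
  unfolding usc_fun_def using assms by (intro allI open_Collect_less) auto

lemma usc_fun_add:
  assumes "usc_fun f" "usc_fun g"
  shows "usc_fun (\<lambda>x. f x + g x)"
  unfolding usc_fun_def
proof
  fix a
  have "{x. f x + g x < a} = (\<Union>q. {x. f x < q} \<inter> {x. g x < a - q})"
  proof (intro equalityI subsetI)
    fix x assume "x \<in> {x. f x + g x < a}"
    then have "f x < a - g x" by auto
    then obtain q where "f x < q" "q < a - g x"
      using dense by blast
    then show "x \<in> (\<Union>q. {x. f x < q} \<inter> {x. g x < a - q})"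
      by (auto intro!: exI[of _ q])
  qed auto
  also have "open \<dots>"
    using assms unfolding usc_fun_def by (intro open_UN ballI open_Int) auto
  finally show "open {x. f x + g x < a}" .
qed

lemma usc_fun_compose:
  assumes "usc_fun f" "continuous_on UNIV h"
  shows "usc_fun (\<lambda>x. f (h x))"
  unfolding usc_fun_def
proof
  fix a
  have "open (h -` {x. f x < a})"
    using assms unfolding usc_fun_def by (intro open_vimage) blast+
  then show "open {x. f (h x) < a}"
    by (simp add: vimage_def)
qed

lemma usc_fun_attains_sup:
  assumes "compact K" "K \<noteq> {}" "usc_fun f"
  shows "\<exists>x\<in>K. \<forall>y\<in>K. f y \<le> f x"
proof (rule ccontr)
  assume "\<not> ?thesis"
  then have "K \<subseteq> (\<Union>y\<in>K. {x. f x < f y})"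
    by (force simp: not_le)
  then obtain D where D: "D \<subseteq> K" "finite D" "K \<subseteq> (\<Union>y\<in>D. {x. f x < f y})"
    using compactE_image[OF assms(1), of K "\<lambda>y. {x. f x < f y}"] assms(3)
    by (auto simp: usc_fun_def)
  then have "D \<noteq> {}"
    using assms(2) by auto
  then have "Max (f ` D) \<in> f ` D"
    using D(2) by simp
  then obtain x where x: "x \<in> D" "f x = Max (f ` D)"
    by auto
  then obtain y where "y \<in> D" "f x < f y"
    using D by blast
  moreover have "f y \<le> Max (f ` D)"
    using \<open>y \<in> D\<close> D(2) by simp
  ultimately show False
    using x(2) by linarith
qed

lemma usc_fun_borel_measurable:
  assumes "usc_fun f"
  shows "f \<in> borel_measurable borel"
proof (rule borel_measurableI_less)
  show "{x \<in> space borel. f x < y} \<in> sets borel" for y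
    using assms by (auto simp: usc_fun_def)
qed

context
  fixes u :: "'a::euclidean_space \<Rightarrow> real" and C :: real
  assumes bound: "\<And>x. \<bar>u x\<bar> \<le> C"
begin

lemma SUP_ball_bounds:
  assumes "e > 0"
  shows "u x \<le> (SUP y\<in>ball x e. u y)" "(SUP y\<in>ball x e. u y) \<le> C"
proof -
  have "bdd_above (u ` ball x e)"
    using bound by (intro bdd_aboveI2[of _ _ C]) (auto simp: abs_le_iff)
  then show "u x \<le> (SUP y\<in>ball x e. u y)"
    using assms by (intro cSUP_upper) auto
  show "(SUP y\<in>ball x e. u y) \<le> C"
    using assms bound by (intro cSUP_least) (auto simp: abs_le_iff)
qed

lemma usc_envelope_le_SUP:
  assumes "e > 0"
  shows "usc_envelope u x \<le> (SUP y\<in>ball x e. u y)"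
  unfolding usc_envelope_def
  using assms SUP_ball_bounds(1)[of _ x]
  by (intro cINF_lower bdd_belowI2[of _ "u x"]) auto

lemma usc_envelope_ge: "u x \<le> usc_envelope u x"
  unfolding usc_envelope_def
  by (rule cINF_greatest) (use SUP_ball_bounds(1) in \<open>auto intro: gt_ex\<close>)

lemma usc_envelope_abs_bound: "\<bar>usc_envelope u x\<bar> \<le> C"
  using usc_envelope_ge[of x] usc_envelope_le_SUP[of 1 x] SUP_ball_bounds(2)[of 1 x] bound[of x]
  by (simp add: abs_le_iff)

lemma usc_fun_usc_envelope: "usc_fun (usc_envelope u)"
  unfolding usc_fun_def open_contains_ball
proof (intro allI ballI)
  fix a x assume "x \<in> {x. usc_envelope u x < a}"
  then have "(INF e\<in>{0<..}. SUP y\<in>ball x e. u y) < a"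
    by (simp add: usc_envelope_def)
  then obtain e where e: "e > 0" "(SUP y\<in>ball x e. u y) < a"
    using cINF_greatest[of "{0<..}" a "\<lambda>e. SUP y\<in>ball x e. u y"]
    by (metis greaterThan_iff greaterThan_non_empty linorder_not_less)
  have "usc_envelope u y < a" if y: "y \<in> ball x e" for y
  proof -
    have d: "e - dist x y > 0"
      using y by simp
    have sub: "ball y (e - dist x y) \<subseteq> ball x e"
    proof
      fix w assume "w \<in> ball y (e - dist x y)"
      then show "w \<in> ball x e"
        using dist_triangle[of x w y] by simp
    qed
    have "usc_envelope u y \<le> (SUP y\<in>ball y (e - dist x y). u y)"
      by (rule usc_envelope_le_SUP[OF d])
    also have "\<dots> \<le> (SUP y\<in>ball x e. u y)"
      using d sub bound by (intro cSUP_subset_mono bdd_aboveI2[of _ _ C]) (auto simp: abs_le_iff)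
    finally show ?thesis
      using e by simp
  qed
  then show "\<exists>e>0. ball x e \<subseteq> {x. usc_envelope u x < a}"
    using e by blast
qed

end

lemma lsc_envelope_eq: "lsc_envelope v x = - usc_envelope (\<lambda>x. - v x) x"
  by (simp add: lsc_envelope_def usc_envelope_def Inf_real_def image_image)

lemma lower_ext_eq: "lower_ext \<Omega> g v x = - upper_ext \<Omega> (\<lambda>x. - g x) (\<lambda>x. - v x) x"
  by (auto simp: lower_ext_def upper_ext_def max_def min_def)

lemma upper_ext_abs_bound:
  assumes "\<And>x. \<bar>u x\<bar> \<le> C" "\<And>x. x \<notin> \<Omega> \<Longrightarrow> \<bar>g x\<bar> \<le> C"
  shows "\<bar>upper_ext \<Omega> g u x\<bar> \<le> C"
  using assms by (auto simp: upper_ext_def max_def)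

lemma upper_ext_borel_measurable:
  fixes \<Omega> :: "'a::euclidean_space set"
  assumes "open \<Omega>" "u \<in> borel_measurable borel" "continuous_on (- \<Omega>) g"
  shows "upper_ext \<Omega> g u \<in> borel_measurable borel"
proof -
  define g' where "g' = (\<lambda>x. if x \<in> \<Omega> then 0 else g x)"
  have [measurable]: "g' \<in> borel_measurable borel"
    unfolding g'_def using assms by (intro borel_measurable_continuous_on_if) auto
  have [measurable]: "\<Omega> \<in> sets borel" "frontier \<Omega> \<in> sets borel"
    using assms by (auto intro: borel_closed)
  note [measurable] = assms(2)
  have "upper_ext \<Omega> g u = (\<lambda>x. if x \<in> \<Omega> then u x else if x \<in> frontier \<Omega> then max (u x) (g' x) else g' x)"
    by (auto simp: upper_ext_def g'_def)
  then show ?thesis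
    by simp
qed

lemma usc_fun_upper_ext:
  fixes \<Omega> :: "'a::euclidean_space set"
  assumes "open \<Omega>" "usc_fun u" "continuous_on (- \<Omega>) g" "\<And>x. x \<notin> \<Omega> \<Longrightarrow> u x \<le> g x"
  shows "usc_fun (upper_ext \<Omega> g u)"
  unfolding usc_fun_def
proof
  fix a
  have "closed {x \<in> - \<Omega>. a \<le> g x}"
    using assms(1,3) continuous_on_closed_Collect_le[of "- \<Omega>" "\<lambda>_. a" g] by auto
  then have "open (- {x \<in> - \<Omega>. a \<le> g x})"
    by auto
  moreover have "{x. upper_ext \<Omega> g u x < a} = {x. u x < a} \<inter> - {x \<in> - \<Omega>. a \<le> g x}"
  proof (intro set_eqI)
    fix x
    show "x \<in> {x. upper_ext \<Omega> g u x < a} \<longleftrightarrow> x \<in> {x. u x < a} \<inter> - {x \<in> - \<Omega>. a \<le> g x}"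
      using assms(4)[of x] by (cases "x \<in> \<Omega>") (auto simp: upper_ext_def)
  qed
  ultimately show "open {x. upper_ext \<Omega> g u x < a}"
    using assms(2) by (auto simp: usc_fun_def)
qed

section \<open>Quadratic test functions\<close>

lemma C2_on_quadratic:
  fixes p y :: "'a::euclidean_space"
  shows "C2_on UNIV (\<lambda>x. b * (norm (x - y))\<^sup>2 + p \<bullet> x)"
proof -
  let ?D = "\<lambda>x. blinfun_inner_right ((2 * b) *\<^sub>R (x - y) + p)"
  let ?D2 = "\<lambda>x::'a. (2 * b) *\<^sub>R Blinfun (blinfun_inner_right :: 'a \<Rightarrow> 'a \<Rightarrow>\<^sub>L real)"
  have "((\<lambda>x. b * (norm (x - y))\<^sup>2 + p \<bullet> x) has_derivative blinfun_apply (?D x)) (at x)" for x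
    unfolding power2_norm_eq_inner
    by (auto intro!: derivative_eq_intros simp: fun_eq_iff inner_add_left inner_diff_left
        inner_commute algebra_simps)
  moreover have "(?D has_derivative blinfun_apply (?D2 x)) (at x)" for x
  proof -
    have "((\<lambda>x. blinfun_inner_right ((2 * b) *\<^sub>R (x - y) + p)) has_derivative
        (\<lambda>h. blinfun_inner_right ((2 * b) *\<^sub>R h))) (at x)"
      by (rule bounded_linear.has_derivative[OF bounded_linear_blinfun_inner_right])
         (auto intro!: derivative_eq_intros)
    moreover have "(\<lambda>h. blinfun_inner_right ((2 * b) *\<^sub>R h)) = blinfun_apply (?D2 x)"
      by (auto simp: fun_eq_iff blinfun.scaleR_left bounded_linear_Blinfun_apply
          bounded_linear_blinfun_inner_right linear_simps(5)[OF bounded_linear_blinfun_inner_right])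
    ultimately show ?thesis
      by simp
  qed
  ultimately show ?thesis
    unfolding C2_on_def
    by (intro conjI exI[of _ ?D] exI[of _ ?D2]) auto
qed

lemma quadratic_along_line:
  fixes x y z p :: "'a::euclidean_space"
  assumes "norm z = 1"
  shows "(b * (norm (x + t *\<^sub>R z - y))\<^sup>2 + p \<bullet> (x + t *\<^sub>R z)) - (b * (norm (x - y))\<^sup>2 + p \<bullet> x)
    = (2 * b * (z \<bullet> (x - y)) + p \<bullet> z) * t + b * t\<^sup>2"
proof -
  have "z \<bullet> z = 1"
    using assms by (simp add: norm_eq_sqrt_inner)
  then show ?thesis
    unfolding power2_norm_eq_inner
    by (simp add: inner_simps inner_commute power2_eq_square algebra_simps)
qed

section \<open>Strictly convex sets\<close>

text \<open>Otherwise \<open>x0\<close> would, in the limit, be the midpoint of a nondegenerate segment with ends in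
  \<open>closure \<Omega>\<close>, and hence lie in \<open>\<Omega>\<close>.\<close>

lemma strictly_convex_short_chords:
  fixes \<Omega> :: "'a::euclidean_space set"
  assumes "bounded \<Omega>" "strictly_convex \<Omega>" "x0 \<notin> \<Omega>" "0 < \<tau>"
  obtains \<rho> where "\<rho> > 0"
    "\<And>x z t. \<lbrakk>x \<in> ball x0 \<rho>; norm z = 1; \<tau> \<le> t; x + t *\<^sub>R z \<in> closure \<Omega>\<rbrakk> \<Longrightarrow> x - t *\<^sub>R z \<notin> closure \<Omega>"
proof -
  let ?S = "(\<lambda>(p, q). (1/2) *\<^sub>R (p + q)) ` ((closure \<Omega> \<times> closure \<Omega>) \<inter> {(p, q). 2 * \<tau> \<le> norm (p - q)})"
  have "closed {(p, q). 2 * \<tau> \<le> norm (p - q :: 'a)}"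
    unfolding split_def by (intro closed_Collect_le continuous_intros)
  then have "compact ?S"
    using assms(1) unfolding split_def
    by (intro compact_continuous_image compact_Int_closed compact_Times continuous_intros)
       (auto simp: compact_closure)
  then have "open (- ?S)"
    by (simp add: compact_imp_closed open_Compl)
  moreover have "x0 \<notin> ?S"
  proof
    assume "x0 \<in> ?S"
    then obtain p q where pq: "p \<in> closure \<Omega>" "q \<in> closure \<Omega>" "2 * \<tau> \<le> norm (p - q)"
      "x0 = (1/2) *\<^sub>R (p + q)"
      by auto
    then have "p \<noteq> q"
      using assms(4) by auto
    then have "open_segment p q \<subseteq> \<Omega>"
      using assms(2) pq by (auto simp: strictly_convex_def)
    moreover have "x0 \<in> open_segment p q"
      using \<open>p \<noteq> q\<close> pq(4) midpoint_in_open_segment[of p q] by (simp add: midpoint_def)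
    ultimately show False
      using assms(3) by auto
  qed
  ultimately obtain \<rho> where \<rho>: "\<rho> > 0" "ball x0 \<rho> \<subseteq> - ?S"
    using open_contains_ball by blast
  show thesis
  proof (rule that[OF \<rho>(1)], rule notI)
    fix x z t assume *: "x \<in> ball x0 \<rho>" "norm z = 1" "\<tau> \<le> t" "x + t *\<^sub>R z \<in> closure \<Omega>"
      "x - t *\<^sub>R z \<in> closure \<Omega>"
    have "norm ((x + t *\<^sub>R z) - (x - t *\<^sub>R z)) = norm ((2 * t) *\<^sub>R z)"
      by (simp add: scaleR_2 flip: scaleR_scaleR)
    also have "\<dots> = 2 * t"
      using * assms(4) by simp
    finally have "2 * \<tau> \<le> norm ((x + t *\<^sub>R z) - (x - t *\<^sub>R z))"
      using *(3) by simp
    moreover have "x = (1/2) *\<^sub>R ((x + t *\<^sub>R z) + (x - t *\<^sub>R z))"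
      by (simp flip: scaleR_2)
    ultimately have "x \<in> ?S"
      using * by (intro image_eqI[where x = "(x + t *\<^sub>R z, x - t *\<^sub>R z)"]) auto
    then show False
      using *(1) \<rho> by auto
  qed
qed

lemma strictly_convex_supporting_functional:
  fixes \<Omega> :: "'a::euclidean_space set"
  assumes "open \<Omega>" "strictly_convex \<Omega>" "x0 \<in> frontier \<Omega>"
  obtains a where "\<And>y. y \<in> closure \<Omega> \<Longrightarrow> y \<noteq> x0 \<Longrightarrow> a \<bullet> x0 < a \<bullet> y"
proof -
  have cv: "convex \<Omega>"
    using assms(2) by (simp add: strictly_convex_def)
  have x0: "x0 \<in> closure \<Omega>" "x0 \<notin> \<Omega>"
    using assms(1,3) by (auto simp: frontier_def interior_open)
  have ri: "rel_interior \<Omega> = \<Omega>"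
    using assms(1) by (simp add: rel_interior_open)
  obtain a where a: "\<And>y. y \<in> closure \<Omega> \<Longrightarrow> a \<bullet> x0 \<le> a \<bullet> y"
    "\<And>y. y \<in> rel_interior \<Omega> \<Longrightarrow> a \<bullet> x0 < a \<bullet> y"
    using supporting_hyperplane_relative_frontier[OF cv x0(1)] x0(2) ri by metis
  show thesis
  proof (rule that)
    fix y assume y: "y \<in> closure \<Omega>" "y \<noteq> x0"
    then have "open_segment x0 y \<subseteq> \<Omega>"
      using assms(2) x0(1) by (auto simp: strictly_convex_def)
    moreover have "midpoint x0 y \<in> open_segment x0 y"
      using y(2) by simp
    ultimately have "midpoint x0 y \<in> \<Omega>"
      by blast
    then have "a \<bullet> x0 < a \<bullet> midpoint x0 y"
      using a(2) ri by auto
    then show "a \<bullet> x0 < a \<bullet> y"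
      by (simp add: midpoint_def inner_simps)
  qed
qed

section \<open>Boundary behaviour\<close>

lemma E_delta_nonposD:
  fixes x y z p :: "'a::euclidean_space"
  assumes s: "0 < s" "s < 1" and \<delta>: "0 < \<delta>"
    and w: "w \<in> borel_measurable borel" "\<And>y. \<bar>w y\<bar> \<le> C"
    and E: "E_delta s f u w (\<lambda>x. b * (norm (x - y))\<^sup>2 + p \<bullet> x) \<delta> x \<le> 0"
    and z: "norm z = 1"
  shows "0 \<le> b * \<delta> powr (2 - 2 * s) / (1 - s) + tail_integral s \<delta> (\<lambda>t. w (x + t *\<^sub>R z) - u x) - f x"
proof -
  let ?\<phi> = "\<lambda>x. b * (norm (x - y))\<^sup>2 + p \<bullet> x"
  note eq = E_z_quadratic[where \<phi> = ?\<phi>, OF s \<delta> quadratic_along_line w]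
  have "bdd_below ((\<lambda>z. E_z s f u w ?\<phi> \<delta> z x) ` sphere 0 1)"
  proof (rule bdd_belowI2)
    fix z :: 'a assume "z \<in> sphere 0 1"
    then have z: "norm z = 1" by simp
    have "(\<lambda>t. w (x + t *\<^sub>R z) - u x) \<in> borel_measurable borel"
      using w(1) by measurable
    moreover have "\<bar>w (x + t *\<^sub>R z) - u x\<bar> \<le> C + \<bar>u x\<bar>" for t
      using w(2)[of "x + t *\<^sub>R z"] by linarith
    ultimately have "- 2 * (C + \<bar>u x\<bar>) * \<delta> powr (- 2 * s) / (2 * s)
        \<le> tail_integral s \<delta> (\<lambda>t. w (x + t *\<^sub>R z) - u x)"
      by (rule tail_integral_lower_bound[OF s(1) \<delta>])
    then show "b * \<delta> powr (2 - 2 * s) / (1 - s) + - 2 * (C + \<bar>u x\<bar>) * \<delta> powr (- 2 * s) / (2 * s) - f x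
        \<le> E_z s f u w ?\<phi> \<delta> z x"
      unfolding eq[OF z] by linarith
  qed
  then have "(INF z\<in>sphere 0 1. E_z s f u w ?\<phi> \<delta> z x) \<le> E_z s f u w ?\<phi> \<delta> z x"
    using z by (intro cINF_lower) auto
  then show ?thesis
    using E unfolding E_delta_def eq[OF z] by linarith
qed

lemma E_delta_nonnegD:
  fixes x y p :: "'a::euclidean_space"
  assumes s: "0 < s" "s < 1" and \<delta>: "0 < \<delta>"
    and w: "w \<in> borel_measurable borel" "\<And>y. \<bar>w y\<bar> \<le> C"
    and E: "0 \<le> E_delta s f u w (\<lambda>x. b * (norm (x - y))\<^sup>2 + p \<bullet> x) \<delta> x"
    and e: "0 < e"
  obtains z where "norm z = 1"
    "b * \<delta> powr (2 - 2 * s) / (1 - s) + tail_integral s \<delta> (\<lambda>t. w (x + t *\<^sub>R z) - u x) - f x < e"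
proof -
  let ?\<phi> = "\<lambda>x. b * (norm (x - y))\<^sup>2 + p \<bullet> x"
  note eq = E_z_quadratic[where \<phi> = ?\<phi>, OF s \<delta> quadratic_along_line w]
  have "\<exists>z\<in>sphere 0 1. E_z s f u w ?\<phi> \<delta> z x < e"
  proof (rule ccontr)
    assume "\<not> ?thesis"
    then have "e \<le> (INF z\<in>sphere 0 1. E_z s f u w ?\<phi> \<delta> z x)"
      by (intro cINF_greatest) (auto simp: not_less)
    then show False
      using E e by (simp add: E_delta_def)
  qed
  then obtain z :: 'a where z: "norm z = 1" "E_z s f u w ?\<phi> \<delta> z x < e"
    by auto
  then show thesis
    using that[OF z(1)] eq[OF z(1)] by simp
qed

lemma boundary_barrier:
  fixes \<Omega> :: "'a::euclidean_space set" and s B :: real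
  assumes s: "0 < s"
    and \<Omega>: "bounded \<Omega>" "open \<Omega>" "strictly_convex \<Omega>"
    and U: "usc_fun U" "\<And>x. \<bar>U x\<bar> \<le> C"
    and g: "continuous_on (- \<Omega>) g" "\<And>x. x \<notin> \<Omega> \<Longrightarrow> \<bar>g x\<bar> \<le> C"
    and ext: "\<And>x. x \<notin> closure \<Omega> \<Longrightarrow> U x \<le> g x"
    and x0: "x0 \<in> frontier \<Omega>" "g x0 < U x0"
  obtains p x \<delta> where "\<delta> > 0" "x \<in> closure \<Omega>" "x \<in> \<Omega> \<or> g x < U x"
    "\<forall>y\<in>ball x \<delta>. U y - p \<bullet> y \<le> U x - p \<bullet> x"
    "\<forall>z. norm z = 1 \<longrightarrow> tail_integral s \<delta> (\<lambda>t. upper_ext \<Omega> g U (x + t *\<^sub>R z) - U x) \<le> - B"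
proof -
  define \<eta> where "\<eta> = (U x0 - g x0) / 4"
  have \<eta>: "\<eta> > 0" "g x0 < U x0 - 3 * \<eta>"
    using x0(2) by (auto simp: \<eta>_def field_simps)
  have x0': "x0 \<in> closure \<Omega>" "x0 \<notin> \<Omega>"
    using x0(1) \<Omega>(2) by (auto simp: frontier_def interior_open)
  let ?w = "upper_ext \<Omega> g U"

  obtain r1 where r1: "r1 > 0" "\<And>y. y \<in> ball x0 r1 \<Longrightarrow> U y < U x0 + \<eta>"
    using usc_fun_nhd[OF U(1), of x0 "U x0 + \<eta>"] \<eta> by auto
  obtain r2 where r2: "r2 > 0" "\<And>y. y \<in> ball x0 r2 \<Longrightarrow> y \<notin> \<Omega> \<Longrightarrow> g y < U x0 - 3 * \<eta>"
  proof -
    have "\<exists>d>0. \<forall>y\<in>- \<Omega>. dist y x0 < d \<longrightarrow> dist (g y) (g x0) < (U x0 - 3 * \<eta>) - g x0"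
      using g(1) x0'(2) \<eta>(2) unfolding continuous_on_iff by simp
    then obtain d where "d > 0" "\<And>y. y \<notin> \<Omega> \<Longrightarrow> dist y x0 < d \<Longrightarrow> dist (g y) (g x0) < (U x0 - 3 * \<eta>) - g x0"
      by auto
    then show thesis
      by (intro that[of d]) (force simp: dist_commute dist_real_def)+
  qed
  define r where "r = min r1 r2 / 2"
  have r: "r > 0"
    using r1 r2 by (simp add: r_def)
  have Ur: "U y < U x0 + \<eta>" and gr: "y \<notin> \<Omega> \<Longrightarrow> g y < U x0 - 3 * \<eta>" if "y \<in> ball x0 (2 * r)" for y
    using that r1 r2 by (auto simp: r_def)

  let ?bound = "\<lambda>\<tau>. ((4 * C + 2 * \<eta>) * r powr (- 2 * s) - (2 * \<eta>) * \<tau> powr (- 2 * s)) / (2 * s)"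
  have "filterlim ?bound at_bot (at_right 0)"
    using s \<eta>(1) by real_asymp
  then have "\<forall>\<^sub>F \<tau> in at_right 0. ?bound \<tau> \<le> - B"
    by (simp add: filterlim_at_bot)
  then have "\<forall>\<^sub>F \<tau> in at_right 0. ?bound \<tau> \<le> - B \<and> 0 < \<tau> \<and> \<tau> < r"
    using eventually_at_right_real[OF r] by eventually_elim auto
  then obtain \<tau> where \<tau>: "?bound \<tau> \<le> - B" "0 < \<tau>" "\<tau> < r"
    using eventually_happens'[OF trivial_limit_at_right_real] by blast

  obtain \<rho>0 where \<rho>0: "\<rho>0 > 0" "\<And>x z t. \<lbrakk>x \<in> ball x0 \<rho>0; norm z = 1; \<tau> \<le> t;
      x + t *\<^sub>R z \<in> closure \<Omega>\<rbrakk> \<Longrightarrow> x - t *\<^sub>R z \<notin> closure \<Omega>"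
    using strictly_convex_short_chords[OF \<Omega>(1,3) x0'(2) \<tau>(2)] by blast
  define \<rho> where "\<rho> = min \<rho>0 r"
  have \<rho>: "\<rho> > 0" "\<rho> \<le> \<rho>0" "\<rho> \<le> r"
    using \<rho>0 r by (auto simp: \<rho>_def)

  obtain a where a: "\<And>y. y \<in> closure \<Omega> \<Longrightarrow> y \<noteq> x0 \<Longrightarrow> a \<bullet> x0 < a \<bullet> y"
    using strictly_convex_supporting_functional[OF \<Omega>(2,3) x0(1)] by blast
  obtain c where c: "c > 0" "\<And>y. y \<in> closure \<Omega> - ball x0 \<rho> \<Longrightarrow> a \<bullet> x0 + c \<le> a \<bullet> y"
  proof (cases "closure \<Omega> - ball x0 \<rho> = {}")
    case True
    then have "a \<bullet> x0 + 1 \<le> a \<bullet> y" if "y \<in> closure \<Omega> - ball x0 \<rho>" for y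
      using that by blast
    then show thesis
      using that[of 1] by simp
  next
    case False
    have "compact (closure \<Omega> - ball x0 \<rho>)"
      using \<Omega>(1) by (intro compact_diff) (auto simp: compact_closure)
    moreover have "continuous_on (closure \<Omega> - ball x0 \<rho>) (\<lambda>y. a \<bullet> y)"
      by (intro continuous_intros)
    ultimately obtain y0 where y0: "y0 \<in> closure \<Omega> - ball x0 \<rho>"
      "\<forall>y\<in>closure \<Omega> - ball x0 \<rho>. a \<bullet> y0 \<le> a \<bullet> y"
      using continuous_attains_inf False by meson
    then have "a \<bullet> x0 < a \<bullet> y0"
      using a[of y0] \<rho>(1) by (cases "y0 = x0") auto
    then show thesis
      using y0(2) by (intro that[of "a \<bullet> y0 - a \<bullet> x0"]) auto
  qed

  define p where "p = ((2 * C + 1) / c) *\<^sub>R a"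
  have C: "C \<ge> 0"
    using U(2)[of x0] by linarith
  have far: "U y - p \<bullet> y < U x0 - p \<bullet> x0" if "y \<in> closure \<Omega> - ball x0 \<rho>" for y
  proof -
    have "(2 * C + 1) / c * c \<le> (2 * C + 1) / c * (a \<bullet> y - a \<bullet> x0)"
      using c(2)[OF that] c(1) C by (intro mult_left_mono) auto
    then have "2 * C + 1 \<le> p \<bullet> y - p \<bullet> x0"
      using c(1) by (simp add: p_def right_diff_distrib)
    then show ?thesis
      using U(2)[of y] U(2)[of x0] by linarith
  qed
  have p: "p \<bullet> x0 \<le> p \<bullet> y" if "y \<in> closure \<Omega>" for y
  proof -
    have "a \<bullet> x0 \<le> a \<bullet> y"
      using a[OF that] by (cases "y = x0") auto
    then have "(2 * C + 1) / c * (a \<bullet> x0) \<le> (2 * C + 1) / c * (a \<bullet> y)"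
      using C c(1) by (intro mult_left_mono) auto
    then show ?thesis
      by (simp add: p_def)
  qed
  have "usc_fun (\<lambda>y. U y + - (p \<bullet> y))"
    by (intro usc_fun_add U(1) usc_fun_continuous continuous_intros)
  moreover have "compact (closure \<Omega>)"
    using \<Omega>(1) by (simp add: compact_closure)
  moreover have "closure \<Omega> \<noteq> {}"
    using x0'(1) by (metis empty_iff)
  ultimately obtain x where x: "x \<in> closure \<Omega>"
    "\<And>y. y \<in> closure \<Omega> \<Longrightarrow> U y - p \<bullet> y \<le> U x - p \<bullet> x"
    using usc_fun_attains_sup[of "closure \<Omega>" "\<lambda>y. U y + - (p \<bullet> y)"]
    unfolding diff_conv_add_uminus by blast
  have x_near: "x \<in> ball x0 \<rho>"
    using far[of x] x(1) x(2)[OF x0'(1)] by force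
  have Ux: "U x0 \<le> U x"
    using x(2)[OF x0'(1)] p[OF x(1)] by linarith
  have near: "y \<in> ball x0 (2 * r)" if "dist x y < r" for y
    using that x_near \<rho>(3) dist_triangle[of x0 y x] by simp

  define \<delta> where "\<delta> = min \<tau> (3 * \<eta> / (norm p + 1))"
  have np: "0 < norm p + 1"
    by (simp add: add_nonneg_pos)
  have \<delta>: "\<delta> > 0" "\<delta> \<le> \<tau>"
    using \<tau>(2) \<eta>(1) np by (simp_all add: \<delta>_def)
  have \<delta>p: "\<delta> * (norm p + 1) \<le> 3 * \<eta>"
    using np unfolding pos_le_divide_eq[OF np, symmetric] \<delta>_def by simp
  show thesis
  proof (rule that[OF \<delta>(1) x(1)])
    show "x \<in> \<Omega> \<or> g x < U x"
      using gr[OF near[of x]] r Ux \<eta>(1) by (cases "x \<in> \<Omega>") auto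
    have "U y - p \<bullet> y \<le> U x - p \<bullet> x" if y: "y \<in> ball x \<delta>" for y
    proof (cases "y \<in> closure \<Omega>")
      case False
      then have "y \<notin> \<Omega>"
        using closure_subset by blast
      then have 1: "U y \<le> U x - 3 * \<eta>"
        using ext[OF False] gr[OF near[of y]] y \<delta> \<tau> Ux by auto
      have "p \<bullet> x - p \<bullet> y \<le> norm p * norm (x - y)"
        using norm_cauchy_schwarz[of p "x - y"] by (simp add: inner_diff_right)
      also have "\<dots> \<le> norm p * \<delta>"
        using y by (intro mult_left_mono) (auto simp: dist_norm)
      also have "\<dots> \<le> 3 * \<eta>"
        using \<delta>p \<delta>(1) by (simp add: algebra_simps)
      finally show ?thesis
        using 1 by linarith
    qed (use x in auto)
    then show "\<forall>y\<in>ball x \<delta>. U y - p \<bullet> y \<le> U x - p \<bullet> x"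
      by blast
    have "tail_integral s \<delta> (\<lambda>t. ?w (x + t *\<^sub>R z) - U x) \<le> - B" if z: "norm z = 1" for z
    proof -
      let ?h = "\<lambda>t. ?w (x + t *\<^sub>R z) - U x"
      have h_meas: "?h \<in> borel_measurable borel"
        using upper_ext_borel_measurable[OF \<Omega>(2) usc_fun_borel_measurable[OF U(1)] g(1)] by measurable
      have wC: "\<bar>?w y\<bar> \<le> C" for y
        by (rule upper_ext_abs_bound[OF U(2) g(2)])
      have h_bd: "\<bar>?h t\<bar> \<le> 2 * C" for t
        using wC[of "x + t *\<^sub>R z"] U(2)[of x] by linarith
      have dichotomy: "?w y \<le> U x - 3 * \<eta> \<or> (y \<in> closure \<Omega> \<and> ?w y = U y)"
        if "y \<in> ball x0 (2 * r)" for y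
        using gr[OF that] Ux closure_subset[of \<Omega>]
        by (auto simp: upper_ext_def frontier_def max_def)
      have top: "?w y \<le> U x + \<eta>" if "y \<in> ball x0 (2 * r)" for y
        using dichotomy[OF that] Ur[OF that] Ux \<eta>(1) by auto
      have w_out: "?w y \<le> U x - 3 * \<eta>" if "y \<in> ball x0 (2 * r)" "y \<notin> closure \<Omega>" for y
        using dichotomy[OF that(1)] that(2) by auto
      have pts: "x + t *\<^sub>R z \<in> ball x0 (2 * r)" "x + (- t) *\<^sub>R z \<in> ball x0 (2 * r)"
        if "0 \<le> t" "t < r" for t
        using that z near[of "x + t *\<^sub>R z"] near[of "x + (- t) *\<^sub>R z"] by (auto simp: dist_norm)
      have "tail_integral s \<delta> ?h \<le> ?bound \<tau>"
      proof (rule tail_integral_upper_bound[OF s \<delta>(1,2) _ h_meas h_bd])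
        show "\<tau> \<le> r" using \<tau> by simp
      next
        fix t assume t: "\<delta> \<le> t" "t < \<tau>"
        let ?y = "x + t *\<^sub>R z" and ?y' = "x + (- t) *\<^sub>R z"
        have y: "?y \<in> ball x0 (2 * r)" "?y' \<in> ball x0 (2 * r)"
          using pts[of t] t \<delta> \<tau> by auto
        consider "?w ?y \<le> U x - 3 * \<eta>" | "?w ?y' \<le> U x - 3 * \<eta>"
          | "?y \<in> closure \<Omega>" "?y' \<in> closure \<Omega>" "?w ?y = U ?y" "?w ?y' = U ?y'"
          using dichotomy[OF y(1)] dichotomy[OF y(2)] by blast
        then show "?h t + ?h (- t) \<le> 0"
        proof cases
          case 3
          have "p \<bullet> ?y + p \<bullet> ?y' = 2 * (p \<bullet> x)"
            by (simp add: inner_add_right inner_diff_right)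
          then show ?thesis
            using x(2)[OF 3(1)] x(2)[OF 3(2)] unfolding 3 by linarith
        qed (use top[OF y(1)] top[OF y(2)] \<eta>(1) in linarith)+
      next
        fix t assume t: "\<tau> \<le> t" "t < r"
        let ?y = "x + t *\<^sub>R z" and ?y' = "x + (- t) *\<^sub>R z"
        have y: "?y \<in> ball x0 (2 * r)" "?y' \<in> ball x0 (2 * r)"
          using pts[of t] t \<tau> by auto
        have "?y \<notin> closure \<Omega> \<or> ?y' \<notin> closure \<Omega>"
          using \<rho>0(2)[of x z t] x_near \<rho>(2) z t by auto
        then show "?h t + ?h (- t) \<le> - (2 * \<eta>)"
          using w_out[OF y(1)] w_out[OF y(2)] top[OF y(1)] top[OF y(2)] by linarith
      next
        show "?h t + ?h (- t) \<le> 4 * C" for t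
          using h_bd[of t] h_bd[of "- t"] by linarith
      qed
      then show "tail_integral s \<delta> ?h \<le> - B"
        using \<tau>(1) by linarith
    qed
    then show "\<forall>z. norm z = 1 \<longrightarrow> tail_integral s \<delta> (\<lambda>t. ?w (x + t *\<^sub>R z) - U x) \<le> - B"
      by blast
  qed
qed

context
  fixes s :: real and \<Omega> :: "'a::euclidean_space set" and f g :: "'a \<Rightarrow> real" and C F :: real
  assumes s: "0 < s" "s < 1"
    and \<Omega>: "bounded \<Omega>" "open \<Omega>" "strictly_convex \<Omega>"
    and f: "continuous_on (closure \<Omega>) f" "\<And>x. x \<in> closure \<Omega> \<Longrightarrow> \<bar>f x\<bar> \<le> F"
    and g: "continuous_on (- \<Omega>) g" "\<And>x. x \<notin> \<Omega> \<Longrightarrow> \<bar>g x\<bar> \<le> C"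
begin

lemma neg_g: "continuous_on (- \<Omega>) (\<lambda>x. - g x)" "x \<notin> \<Omega> \<Longrightarrow> \<bar>- g x\<bar> \<le> C"
  using g by (auto intro: continuous_intros)

lemma frontier_iff: "x \<in> frontier \<Omega> \<longleftrightarrow> x \<in> closure \<Omega> \<and> x \<notin> \<Omega>"
  using \<Omega>(2) by (auto simp: frontier_def interior_open)

lemma sub_le_boundary_data:
  assumes U: "usc_fun U" "\<And>x. \<bar>U x\<bar> \<le> C" and sub: "visc_sub_usc s \<Omega> f g U" and x0: "x0 \<notin> \<Omega>"
  shows "U x0 \<le> g x0"
proof (rule ccontr)
  assume gt: "\<not> U x0 \<le> g x0"
  have ext: "U x \<le> g x" if "x \<notin> closure \<Omega>" for x
    using sub that by (auto simp: visc_sub_usc_def)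
  then have viol: "x0 \<in> frontier \<Omega>" "g x0 < U x0"
    using gt x0 by (auto simp: frontier_iff)
  obtain p x \<delta> where b: "\<delta> > 0" "x \<in> closure \<Omega>" "x \<in> \<Omega> \<or> g x < U x"
    "\<forall>y\<in>ball x \<delta>. U y - p \<bullet> y \<le> U x - p \<bullet> x"
    "\<forall>z. norm z = 1 \<longrightarrow> tail_integral s \<delta> (\<lambda>t. upper_ext \<Omega> g U (x + t *\<^sub>R z) - U x) \<le> - (F + 1)"
    by (rule boundary_barrier[where B = "F + 1", OF s(1) \<Omega> U g ext viol]) (assumption | rule that)+
  let ?\<phi> = "\<lambda>x. 0 * (norm (x - 0))\<^sup>2 + p \<bullet> x"
  have "E_delta s f U (upper_ext \<Omega> g U) ?\<phi> \<delta> x \<le> 0"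
  proof (cases "x \<in> \<Omega>")
    case True
    then show ?thesis
      using sub C2_on_quadratic[of 0 0 p] b(1,4) unfolding visc_sub_usc_def by simp
  next
    case False
    then have "min (E_delta s f U (upper_ext \<Omega> g U) ?\<phi> \<delta> x) (U x - g x) \<le> 0"
      using sub C2_on_quadratic[of 0 0 p] b(1,2,4) frontier_iff unfolding visc_sub_usc_def by simp
    then show ?thesis
      using b(3) False by (auto simp: min_def split: if_splits)
  qed
  moreover obtain z :: 'a where z: "norm z = 1"
    using vector_choose_size[of 1] by auto
  ultimately have "0 \<le> 0 * \<delta> powr (2 - 2 * s) / (1 - s)
      + tail_integral s \<delta> (\<lambda>t. upper_ext \<Omega> g U (x + t *\<^sub>R z) - U x) - f x"
    using upper_ext_borel_measurable[OF \<Omega>(2) usc_fun_borel_measurable[OF U(1)] g(1)]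
      upper_ext_abs_bound[OF U(2) g(2)]
    by (intro E_delta_nonposD[OF s b(1)]) auto
  then show False
    using b(5)[rule_format, OF z] f(2)[OF b(2)] by simp
qed

lemma super_ge_boundary_data:
  assumes V: "usc_fun V" "\<And>x. \<bar>V x\<bar> \<le> C" and super: "visc_super_lsc s \<Omega> f g (\<lambda>x. - V x)"
    and x0: "x0 \<notin> \<Omega>"
  shows "V x0 \<le> - g x0"
proof (rule ccontr)
  assume gt: "\<not> V x0 \<le> - g x0"
  have ext: "V x \<le> - g x" if "x \<notin> closure \<Omega>" for x
    using super that unfolding visc_super_lsc_def by force
  then have viol: "x0 \<in> frontier \<Omega>" "- g x0 < V x0"
    using gt x0 by (auto simp: frontier_iff)
  obtain p x \<delta> where b: "\<delta> > 0" "x \<in> closure \<Omega>" "x \<in> \<Omega> \<or> - g x < V x"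
    "\<forall>y\<in>ball x \<delta>. V y - p \<bullet> y \<le> V x - p \<bullet> x"
    "\<forall>z. norm z = 1 \<longrightarrow> tail_integral s \<delta>
      (\<lambda>t. upper_ext \<Omega> (\<lambda>x. - g x) V (x + t *\<^sub>R z) - V x) \<le> - (F + 2)"
    by (rule boundary_barrier[where B = "F + 2", OF s(1) \<Omega> V neg_g ext viol]) (assumption | rule that)+
  let ?w = "upper_ext \<Omega> (\<lambda>x. - g x) V"
  let ?\<phi> = "\<lambda>x. 0 * (norm (x - 0))\<^sup>2 + (- p) \<bullet> x"
  have w: "lower_ext \<Omega> g (\<lambda>x. - V x) = (\<lambda>x. - ?w x)"
    by (simp add: fun_eq_iff lower_ext_eq)
  have touch: "\<forall>y\<in>ball x \<delta>. - V y - ?\<phi> y \<ge> - V x - ?\<phi> x"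
    using b(4) by (simp add: algebra_simps)
  have wm: "(\<lambda>x. - ?w x) \<in> borel_measurable borel"
    using upper_ext_borel_measurable[OF \<Omega>(2) usc_fun_borel_measurable[OF V(1)] neg_g(1)] by measurable
  have wb: "\<bar>- ?w x\<bar> \<le> C" for x
    using upper_ext_abs_bound[where u = V and g = "\<lambda>x. - g x", OF V(2) neg_g(2)] by simp
  have "0 \<le> E_delta s f (\<lambda>x. - V x) (\<lambda>x. - ?w x) ?\<phi> \<delta> x"
  proof (cases "x \<in> \<Omega>")
    case True
    then show ?thesis
      using super C2_on_quadratic[of 0 0 "- p"] b(1) touch unfolding visc_super_lsc_def w by blast
  next
    case False
    then have "max (E_delta s f (\<lambda>x. - V x) (\<lambda>x. - ?w x) ?\<phi> \<delta> x) (- V x - g x) \<ge> 0"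
      using super C2_on_quadratic[of 0 0 "- p"] b(1,2) touch frontier_iff
      unfolding visc_super_lsc_def w by blast
    then show ?thesis
      using b(3) False by (auto simp: max_def split: if_splits)
  qed
  then obtain z where z: "norm z = 1"
    "0 * \<delta> powr (2 - 2 * s) / (1 - s)
      + tail_integral s \<delta> (\<lambda>t. - ?w (x + t *\<^sub>R z) - - V x) - f x < 1"
    by (rule E_delta_nonnegD[OF s b(1) wm wb _ zero_less_one]) (assumption | rule that)+
  have "(\<lambda>t. - ?w (x + t *\<^sub>R z) - - V x) = (\<lambda>t. - (?w (x + t *\<^sub>R z) - V x))"
    by auto
  then have "tail_integral s \<delta> (\<lambda>t. - ?w (x + t *\<^sub>R z) - - V x) \<ge> F + 2"
    using b(5)[rule_format, OF z(1)] by (simp only: tail_integral_uminus)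
  then show False
    using z(2) f(2)[OF b(2)] by simp
qed

lemma comparison_envelopes:
  assumes U: "usc_fun U" "\<And>x. \<bar>U x\<bar> \<le> C" and sub: "visc_sub_usc s \<Omega> f g U"
    and V: "usc_fun V" "\<And>x. \<bar>V x\<bar> \<le> C" and super: "visc_super_lsc s \<Omega> f g (\<lambda>x. - V x)"
  shows "U x + V x \<le> 0"
proof (rule ccontr)
  assume pos: "\<not> U x + V x \<le> 0"
  have Ug: "U y \<le> g y" and Vg: "V y \<le> - g y" if "y \<notin> \<Omega>" for y
    using sub_le_boundary_data[OF U sub that] super_ge_boundary_data[OF V super that] by auto
  define w where "w = upper_ext \<Omega> g U"
  define w' where "w' = upper_ext \<Omega> (\<lambda>x. - g x) V"
  have w_in: "w y = U y" "w' y = V y" if "y \<in> \<Omega>" for y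
    using that by (auto simp: w_def w'_def upper_ext_def)
  have w_out: "w y = g y" "w' y = - g y" if "y \<notin> \<Omega>" for y
    using that Ug Vg by (auto simp: w_def w'_def upper_ext_def)
  have usc: "usc_fun w" "usc_fun w'"
    unfolding w_def w'_def using \<Omega>(2) U(1) V(1) g(1) neg_g(1) Ug Vg by (auto intro!: usc_fun_upper_ext)
  note meas = usc[THEN usc_fun_borel_measurable]
  have bd: "\<bar>w y\<bar> \<le> C" "\<bar>w' y\<bar> \<le> C" for y
    unfolding w_def w'_def
    using upper_ext_abs_bound[of U C \<Omega> g] upper_ext_abs_bound[of V C \<Omega> "\<lambda>x. - g x"] U(2) V(2) g(2)
    by auto

  obtain r where r: "r > 0" "\<Omega> \<subseteq> ball 0 r"
    using bounded_subset_ballD[OF \<Omega>(1)] by blast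
  define K where "K = cball (0::'a) (3 * r)"
  have K: "compact K" "K \<noteq> {}" "\<Omega> \<subseteq> K"
    using r by (auto simp: K_def subset_eq)
  obtain xm where xm: "xm \<in> K" "\<And>y. y \<in> K \<Longrightarrow> w y + w' y \<le> w xm + w' xm"
    using usc_fun_attains_sup[OF K(1,2) usc_fun_add[OF usc]] by blast
  define M where "M = w xm + w' xm"
  have "x \<in> \<Omega>"
    using pos Ug[of x] Vg[of x] by fastforce
  then have M: "M > 0"
    using xm(2)[of x] K(3) pos w_in[of x] by (auto simp: M_def)

  text \<open>Far from \<open>\<Omega>\<close> the two extensions agree, so the positive gap \<open>M\<close> makes the equation strict there;
    this replaces the usual perturbation to a strict subsolution.\<close>
  let ?bound = "\<lambda>R. ((8 * C + M) * R powr (- 2 * s) - M * (2 * r) powr (- 2 * s)) / (2 * s)"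
  have "((\<lambda>R::real. R powr (- 2 * s)) \<longlongrightarrow> 0) at_top"
    using s by real_asymp
  then have "(?bound \<longlongrightarrow> ((8 * C + M) * 0 - M * (2 * r) powr (- 2 * s)) / (2 * s)) at_top"
    using s by (intro tendsto_intros) auto
  moreover have "((8 * C + M) * 0 - M * (2 * r) powr (- 2 * s)) / (2 * s) < 0"
    using s M r by (simp add: divide_neg_pos)
  ultimately have "\<forall>\<^sub>F R in at_top. ?bound R < 0"
    by (rule order_tendstoD(2))
  then have "\<forall>\<^sub>F R in at_top. ?bound R < 0 \<and> 2 * r \<le> R"
    using eventually_ge_at_top[of "2 * r"] by eventually_elim auto
  then obtain R where R: "?bound R < 0" "2 * r \<le> R"
    using eventually_happens'[OF trivial_limit_at_top_linorder] by blast
  define c where "c = - ?bound R"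
  have c: "c > 0"
    using R by (simp add: c_def)

  obtain d1 where d1: "d1 > 0" "\<And>x y. \<lbrakk>x \<in> K; y \<in> K; M \<le> w x + w' y; dist x y < d1\<rbrakk> \<Longrightarrow> x \<in> \<Omega> \<and> y \<in> \<Omega>"
  proof -
    let ?T = "(K \<times> K) \<inter> - {q. w (fst q) + w' (snd q) < M} \<inter> - (\<Omega> \<times> \<Omega>)"
    have "usc_fun (\<lambda>q. w (fst q) + w' (snd q))"
      by (intro usc_fun_add usc_fun_compose[OF usc(1)] usc_fun_compose[OF usc(2)] continuous_intros)
    then have "closed (- {q. w (fst q) + w' (snd q) < M})" "closed (- (\<Omega> \<times> \<Omega>))"
      using \<Omega>(2) by (auto simp: usc_fun_def open_Times)
    then have T: "compact ?T"
      by (intro compact_Int_closed compact_Times K(1))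
    have pos: "dist (fst q) (snd q) > 0" if "q \<in> ?T" for q
    proof -
      obtain a b where q: "q = (a, b)" by (cases q)
      have "a \<noteq> b"
        using that w_out[of a] M unfolding q by (cases "a \<in> \<Omega>") auto
      then show ?thesis
        by (simp add: q)
    qed
    show thesis
    proof (cases "?T = {}")
      case True
      have "x \<in> \<Omega> \<and> y \<in> \<Omega>" if "x \<in> K" "y \<in> K" "M \<le> w x + w' y" for x y
      proof (rule ccontr)
        assume "\<not> ?thesis"
        then have "(x, y) \<in> ?T"
          using that by (auto simp: not_less)
        then show False
          using True by blast
      qed
      then show thesis
        using that[of 1] by simp
    next
      case False
      have "continuous_on ?T (\<lambda>q. dist (fst q) (snd q))"
        by (intro continuous_intros)
      from continuous_attains_inf[OF T False this]
      obtain q0 where q0: "q0 \<in> ?T" "\<And>q. q \<in> ?T \<Longrightarrow> dist (fst q0) (snd q0) \<le> dist (fst q) (snd q)"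
        by meson
      show thesis
      proof (rule that[OF pos[OF q0(1)]], rule ccontr)
        fix x y assume *: "x \<in> K" "y \<in> K" "M \<le> w x + w' y"
          "dist x y < dist (fst q0) (snd q0)" "\<not> (x \<in> \<Omega> \<and> y \<in> \<Omega>)"
        then have "(x, y) \<in> ?T"
          by (auto simp: not_less)
        then show False
          using q0(2)[of "(x, y)"] *(4) by simp
      qed
    qed
  qed
  have "uniformly_continuous_on (closure \<Omega>) f"
    using f(1) \<Omega>(1) by (intro compact_uniformly_continuous) (auto simp: compact_closure)
  then obtain d2 where d2: "d2 > 0"
    "\<And>x y. \<lbrakk>x \<in> closure \<Omega>; y \<in> closure \<Omega>; dist x y < d2\<rbrakk> \<Longrightarrow> \<bar>f x - f y\<bar> < c / 3"
    using c unfolding uniformly_continuous_on_def dist_real_def by (metis divide_pos_pos zero_less_numeral)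
  have "uniformly_continuous_on (cball 0 (r + R) \<inter> - \<Omega>) g"
    using g(1) \<Omega>(2)
    by (intro compact_uniformly_continuous compact_Int_closed) (auto intro: continuous_on_subset)
  then obtain d3 where d3: "d3 > 0"
    "\<And>x y. \<lbrakk>x \<in> cball 0 (r + R) \<inter> - \<Omega>; y \<in> cball 0 (r + R) \<inter> - \<Omega>; dist x y < d3\<rbrakk> \<Longrightarrow> \<bar>g x - g y\<bar> < M / 2"
    using M unfolding uniformly_continuous_on_def dist_real_def by (metis half_gt_zero)
  define d where "d = min d1 (min d2 d3)"
  have d: "d > 0" "d \<le> d1" "d \<le> d2" "d \<le> d3"
    using d1 d2 d3 by (auto simp: d_def)

  define n where "n = (2 * C + 1) / d\<^sup>2"
  have C: "C \<ge> 0"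
    using U(2)[of x] by linarith
  have n: "n > 0"
    using C d by (simp add: n_def add_nonneg_pos)
  let ?\<Phi> = "\<lambda>q. w (fst q) + w' (snd q) + - n * (norm (fst q - snd q))\<^sup>2"
  have "usc_fun ?\<Phi>"
    by (intro usc_fun_add usc_fun_compose[OF usc(1)] usc_fun_compose[OF usc(2)] usc_fun_continuous
        continuous_intros)
  then obtain q where q: "q \<in> K \<times> K" "\<And>q'. q' \<in> K \<times> K \<Longrightarrow> ?\<Phi> q' \<le> ?\<Phi> q"
    using usc_fun_attains_sup[of "K \<times> K" ?\<Phi>] compact_Times[OF K(1) K(1)] K(2) by blast
  obtain a b where ab: "q = (a, b)" by (cases q)
  have abK: "a \<in> K" "b \<in> K"
    using q(1) by (auto simp: ab)
  have max: "w y + w' y' - n * (norm (y - y'))\<^sup>2 \<le> w a + w' b - n * (norm (a - b))\<^sup>2"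
    if "y \<in> K" "y' \<in> K" for y y'
    using q(2)[of "(y, y')"] that by (simp add: ab)
  have gap: "M + n * (norm (a - b))\<^sup>2 \<le> w a + w' b"
    using max[OF xm(1) xm(1)] by (simp add: M_def)
  have close: "dist a b < d"
  proof (rule ccontr)
    assume "\<not> dist a b < d"
    then have "d\<^sup>2 \<le> (norm (a - b))\<^sup>2"
      using d(1) by (intro power_mono) (auto simp: dist_norm)
    then have "n * d\<^sup>2 \<le> n * (norm (a - b))\<^sup>2"
      using n by simp
    moreover have "n * d\<^sup>2 = 2 * C + 1"
      using d(1) by (simp add: n_def)
    ultimately show False
      using gap bd(1)[of a] bd(2)[of b] M by linarith
  qed
  have "0 \<le> n * (norm (a - b))\<^sup>2"
    using n by simp
  then have Mab: "M \<le> w a + w' b"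
    using gap by linarith
  then have in_\<Omega>: "a \<in> \<Omega>" "b \<in> \<Omega>"
    using d1(2)[OF abK] close d(2) by auto
  have ab_r: "norm a < r" "norm b < r"
    using in_\<Omega> r(2) by auto

  obtain e1 e2 where e: "e1 > 0" "ball a e1 \<subseteq> \<Omega>" "e2 > 0" "ball b e2 \<subseteq> \<Omega>"
    using in_\<Omega> \<Omega>(2) by (meson open_contains_ball)
  have "((\<lambda>\<delta>::real. n * \<delta> powr (2 - 2 * s) / (1 - s)) \<longlongrightarrow> 0) (at_right 0)"
    using s by real_asymp
  then have "\<forall>\<^sub>F \<delta> in at_right 0. n * \<delta> powr (2 - 2 * s) / (1 - s) < c / 6"
    using c by (intro order_tendstoD(2)[where y = 0]) auto
  moreover have "0 < min (min e1 e2) (2 * r)"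
    using e r by auto
  ultimately have "\<forall>\<^sub>F \<delta> in at_right 0. n * \<delta> powr (2 - 2 * s) / (1 - s) < c / 6 \<and>
      0 < \<delta> \<and> \<delta> < min (min e1 e2) (2 * r)"
    using eventually_at_right_real[of 0 "min (min e1 e2) (2 * r)"]
    by (auto elim: eventually_elim2)
  then obtain \<delta> where \<delta>: "n * \<delta> powr (2 - 2 * s) / (1 - s) < c / 6" "0 < \<delta>" "\<delta> < e1" "\<delta> < e2" "\<delta> < 2 * r"
    using eventually_happens'[OF trivial_limit_at_right_real] by fastforce
  define \<kappa> where "\<kappa> = n * \<delta> powr (2 - 2 * s) / (1 - s)"

  have "E_delta s f U w (\<lambda>y. n * (norm (y - b))\<^sup>2 + 0 \<bullet> y) \<delta> a \<le> 0"
  proof -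
    have "\<forall>y\<in>ball a \<delta>. U y - (n * (norm (y - b))\<^sup>2 + 0 \<bullet> y) \<le> U a - (n * (norm (a - b))\<^sup>2 + 0 \<bullet> a)"
    proof
      fix y assume "y \<in> ball a \<delta>"
      then have "y \<in> \<Omega>"
        using e(2) \<delta>(3) by auto
      then show "U y - (n * (norm (y - b))\<^sup>2 + 0 \<bullet> y) \<le> U a - (n * (norm (a - b))\<^sup>2 + 0 \<bullet> a)"
        using max[of y b] abK K(3) w_in in_\<Omega> by auto
    qed
    then show ?thesis
      using sub C2_on_quadratic[of n b 0] \<delta>(2) in_\<Omega>(1) unfolding visc_sub_usc_def w_def[symmetric] by blast
  qed
  note sub_ineq = E_delta_nonposD[OF s \<delta>(2) meas(1) bd(1) this]

  have lw: "lower_ext \<Omega> g (\<lambda>x. - V x) = (\<lambda>x. - w' x)"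
    by (simp add: fun_eq_iff lower_ext_eq w'_def)
  have super_E: "0 \<le> E_delta s f (\<lambda>x. - V x) (\<lambda>x. - w' x) (\<lambda>y. (- n) * (norm (y - a))\<^sup>2 + 0 \<bullet> y) \<delta> b"
  proof -
    have "\<forall>y\<in>ball b \<delta>. - V y - ((- n) * (norm (y - a))\<^sup>2 + 0 \<bullet> y) \<ge> - V b - ((- n) * (norm (b - a))\<^sup>2 + 0 \<bullet> b)"
    proof
      fix y assume "y \<in> ball b \<delta>"
      then have "y \<in> \<Omega>"
        using e(4) \<delta>(4) by auto
      then show "- V y - ((- n) * (norm (y - a))\<^sup>2 + 0 \<bullet> y) \<ge> - V b - ((- n) * (norm (b - a))\<^sup>2 + 0 \<bullet> b)"
        using max[of a y] abK K(3) w_in in_\<Omega> by (auto simp: norm_minus_commute)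
    qed
    then show ?thesis
      using super C2_on_quadratic[of "- n" a 0] \<delta>(2) in_\<Omega>(2) unfolding visc_super_lsc_def lw by blast
  qed
  have "(\<lambda>x. - w' x) \<in> borel_measurable borel" "\<And>x. \<bar>- w' x\<bar> \<le> C"
    using meas(2) bd(2) by auto
  from E_delta_nonnegD[OF s \<delta>(2) this super_E, of "c / 3"] c
  obtain z where z: "norm z = 1"
    "(- n) * \<delta> powr (2 - 2 * s) / (1 - s) + tail_integral s \<delta> (\<lambda>t. - w' (b + t *\<^sub>R z) - - V b) - f b < c / 3"
    by auto

  let ?h = "\<lambda>t. w (a + t *\<^sub>R z) - U a" and ?k = "\<lambda>t. w' (b + t *\<^sub>R z) - V b"
  have hk_meas: "?h \<in> borel_measurable borel" "?k \<in> borel_measurable borel"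
    using meas by measurable
  have hk_bd: "\<bar>?h t\<bar> \<le> 2 * C" "\<bar>?k t\<bar> \<le> 2 * C" for t
    using bd(1)[of "a + t *\<^sub>R z"] U(2)[of a] bd(2)[of "b + t *\<^sub>R z"] V(2)[of b] by linarith+
  have "(\<lambda>t. - w' (b + t *\<^sub>R z) - - V b) = (\<lambda>t. - ?k t)"
    by auto
  then have "tail_integral s \<delta> (\<lambda>t. - w' (b + t *\<^sub>R z) - - V b) = - tail_integral s \<delta> ?k"
    by (simp only: tail_integral_uminus)
  then have k_ineq: "- \<kappa> - tail_integral s \<delta> ?k - f b < c / 3"
    using z(2) by (simp add: \<kappa>_def)
  have h_ineq: "0 \<le> \<kappa> + tail_integral s \<delta> ?h - f a"
    using sub_ineq[OF z(1)] by (simp add: \<kappa>_def)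
  have "\<bar>f a - f b\<bar> < c / 3"
    using d2(2)[of a b] in_\<Omega> closure_subset[of \<Omega>] close d by auto
  then have lower: "tail_integral s \<delta> ?h + tail_integral s \<delta> ?k > - c"
    using k_ineq h_ineq \<delta>(1) unfolding \<kappa>_def[symmetric] by linarith

  have inner: "?h t + ?k t \<le> 0" if "\<bar>t\<bar> \<le> 2 * r" for t
  proof -
    have "norm (a + t *\<^sub>R z) \<le> 3 * r" "norm (b + t *\<^sub>R z) \<le> 3 * r"
      using norm_triangle_ineq[of a "t *\<^sub>R z"] norm_triangle_ineq[of b "t *\<^sub>R z"] z(1) that ab_r by auto
    then show ?thesis
      using max[of "a + t *\<^sub>R z" "b + t *\<^sub>R z"] w_in in_\<Omega> by (simp add: K_def)
  qed
  have middle: "?h t + ?k t \<le> - (M / 2)" if "2 * r \<le> \<bar>t\<bar>" "\<bar>t\<bar> \<le> R" for t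
  proof -
    have n1: "norm (a + t *\<^sub>R z) \<le> r + R" "norm (b + t *\<^sub>R z) \<le> r + R"
      using norm_triangle_ineq[of a "t *\<^sub>R z"] norm_triangle_ineq[of b "t *\<^sub>R z"] z(1) that ab_r by auto
    have "norm (a + t *\<^sub>R z) > r" "norm (b + t *\<^sub>R z) > r"
      using norm_diff_ineq[of "t *\<^sub>R z" a] norm_diff_ineq[of "t *\<^sub>R z" b] z(1) that ab_r
      by (auto simp: add.commute)
    then have out: "a + t *\<^sub>R z \<notin> \<Omega>" "b + t *\<^sub>R z \<notin> \<Omega>"
      using r(2) by auto
    have "\<bar>g (a + t *\<^sub>R z) - g (b + t *\<^sub>R z)\<bar> < M / 2"
      using n1 out close d by (intro d3(2)) auto
    then show ?thesis
      using Mab w_in(1)[OF in_\<Omega>(1)] w_in(2)[OF in_\<Omega>(2)] w_out(1)[OF out(1)] w_out(2)[OF out(2)]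
      by linarith
  qed
  have "tail_integral s \<delta> (\<lambda>t. ?h t + ?k t) \<le> ?bound R"
  proof (rule tail_integral_upper_bound[OF s(1) \<delta>(2)])
    show "(\<lambda>t. ?h t + ?k t) \<in> borel_measurable borel"
      using hk_meas by measurable
    show "\<bar>?h t + ?k t\<bar> \<le> 4 * C" for t
      using hk_bd[of t] by linarith
    show "?h t + ?k t + (?h (- t) + ?k (- t)) \<le> 0" if "\<delta> \<le> t" "t < 2 * r" for t
      using inner[of t] inner[of "- t"] that \<delta> by auto
    show "?h t + ?k t + (?h (- t) + ?k (- t)) \<le> - M" if "2 * r \<le> t" "t < R" for t
      using middle[of t] middle[of "- t"] that r by auto
    show "?h t + ?k t + (?h (- t) + ?k (- t)) \<le> 8 * C" for t
      using hk_bd[of t] hk_bd[of "- t"] by linarith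
  qed (use \<delta> R in auto)
  also have "tail_integral s \<delta> (\<lambda>t. ?h t + ?k t) = tail_integral s \<delta> ?h + tail_integral s \<delta> ?k"
    by (rule tail_integral_add[OF s(1) \<delta>(2) hk_meas(1) hk_bd(1) hk_meas(2) hk_bd(2)])
  finally show False
    using lower by (simp add: c_def)
qed

end

theorem theorem2p2:
  fixes s :: real and \<Omega> :: "'a::euclidean_space set"
    and f g u v :: "'a \<Rightarrow> real"
  assumes "0 < s" "s < 1"
    and "bounded \<Omega>" "C2_domain \<Omega>" "strictly_convex \<Omega>"
    and "continuous_on (closure \<Omega>) f" "bounded (f ` closure \<Omega>)"
    and "continuous_on (closure (- \<Omega>)) g" "bounded (g ` closure (- \<Omega>))"
    and "visc_subsolution s \<Omega> f g u"
    and "visc_supersolution s \<Omega> f g v"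
  shows "\<forall>x. u x \<le> v x"
proof
  fix x
  have op: "open \<Omega>"
    using assms(4) by (simp add: C2_domain_def)
  then have cl: "closure (- \<Omega>) = - \<Omega>"
    by (simp add: closure_closed closed_Compl)
  obtain Cu where Cu: "\<And>x. \<bar>u x\<bar> \<le> Cu"
    using assms(10) by (auto simp: visc_subsolution_def bounded_iff)
  obtain Cv where Cv: "\<And>x. \<bar>v x\<bar> \<le> Cv"
    using assms(11) by (auto simp: visc_supersolution_def bounded_iff)
  obtain Cg where Cg: "\<And>x. x \<notin> \<Omega> \<Longrightarrow> \<bar>g x\<bar> \<le> Cg"
    using assms(9) unfolding cl by (auto simp: bounded_iff)
  obtain F where F: "\<And>x. x \<in> closure \<Omega> \<Longrightarrow> \<bar>f x\<bar> \<le> F"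
    using assms(7) by (auto simp: bounded_iff)
  define C where "C = max Cu (max Cv Cg)"
  have C: "\<bar>u y\<bar> \<le> C" "\<bar>- v y\<bar> \<le> C" "y \<notin> \<Omega> \<Longrightarrow> \<bar>g y\<bar> \<le> C" for y
    using Cu[of y] Cv[of y] Cg[of y] by (auto simp: C_def)
  let ?U = "usc_envelope u" and ?V = "usc_envelope (\<lambda>x. - v x)"
  have "lsc_envelope v = (\<lambda>x. - ?V x)"
    by (simp add: fun_eq_iff lsc_envelope_eq)
  then have sol: "visc_sub_usc s \<Omega> f g ?U" "visc_super_lsc s \<Omega> f g (\<lambda>x. - ?V x)"
    using assms(10,11) by (auto simp: visc_subsolution_def visc_supersolution_def)
  have "?U x + ?V x \<le> 0"
    using comparison_envelopes[OF assms(1-3) op assms(5,6) F _ C(3)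
        usc_fun_usc_envelope[OF C(1)] usc_envelope_abs_bound[OF C(1)] sol(1)
        usc_fun_usc_envelope[OF C(2)] usc_envelope_abs_bound[OF C(2)] sol(2)] assms(8) cl by simp
  moreover have "u x \<le> ?U x" "- v x \<le> ?V x"
    by (rule usc_envelope_ge[OF C(1)], rule usc_envelope_ge[OF C(2)])
  ultimately show "u x \<le> v x"
    by linarith
qed

end
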